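(* Let $\Theta_3$ be the graph with two vertices joined by three parallel edges $e_1,e_2,e_3$ of lengths $(\ell_1,\ell_2,\ell_3)=(a,b,c)$, with standard Kirchhoff conditions at both vertices, and assume $\ell=(a,b,c)$ belongs to the generic class $\mathcal G_{\Theta_3}$. Observe the second and third edges completely and not the first, i.e. let $\omega$ be measurable with edgewise measures $\alpha=(0,b,c)$. Then $$C_\infty=C_\infty(\omega;\ell)=\frac{bc}{ab+ac+bc},$$ and $$C_\infty<C_{\mathrm{prim}}:=\min\left\{\frac{b}{a+b},\frac{c}{a+c}\right\}.$$ A minimizing intensity (a minimizer of $q\mapsto\alpha\cdot q$ over $I(\ell)$) is proportional to $\bigl((b+c)^2,c^2,b^2\bigr)$, which has support on all three edges and is therefore not supported on a primitive support (a two-edge cycle).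
   Context: For a finite compact metric graph $G$ with edge set $E$, lengths $\ell$, and standard Kirchhoff conditions (continuity, vanishing sum of outward derivatives) at every vertex, $-\Delta_{G,\ell}$ acts as $-d^2/dx^2$ on each edge $e\cong[0,\ell_e]$. $C_\infty(\omega;\ell):=\lim_{\Lambda\to\infty}\inf\{\int_\omega|u|^2:\ -\Delta_{G,\ell}u=\lambda u,\ \lambda\ge\Lambda,\ \|u\|_{L^2(G)}=1\}$. For $-\Delta_{G,\ell}u=k^2u$, $k>0$, $u_e(x)=A_e\cos(kx)+B_e\sin(kx)$, put $q_e(u)=(|A_e|^2+|B_e|^2)/2$. $I(\ell)$ is the set of all limits $\lim_nq(u_n)$ with $\|u_n\|_{L^2}=1$, $-\Delta_{G,\ell}u_n=k_n^2u_n$, $k_n\to\infty$. $C_{\mathrm{prim}}$ is the smallest observation ratio $\sum_{e\subset P}\alpha_e/\sum_{e\subset P}\ell_e$ over the primitive supports $P$ of $\Theta_3$, which are the three two-edge cycles (ratios $\frac b{a+b},\frac c{a+c},1$). **Generic class $\mathcal G_G$.** Orient the edges. For $\theta\in(\mathbb R/2\pi\mathbb Z)^E$ let $N(\theta)$ be the space of families $(A_e,B_e)_{e\in E}$ such that the edge functions $A_e\cos t+B_e\sin t$, having value $A_e$ and outward derivative $B_e$ at the initial endpoint, and value $A_e\cos\theta_e+B_e\sin\theta_e$ and outward derivative $A_e\sin\theta_e-B_e\cos\theta_e$ at the final endpoint, satisfy the Kirchhoff condition at every vertex. The determinant manifold is $\{\theta:N(\theta)\neq0\}$, with singular part $\{\theta:\dim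 N(\theta)\ge2\}$. $\mathcal G_G$ is the set of $\ell\in(0,\infty)^E$ with rationally independent components whose phase line $\{k\ell\bmod2\pi:k>0\}$ does not meet the singular part; equivalently, in that setting, the positive Laplace spectrum is simple. *)

theory Defs
  imports "HOL-Analysis.Analysis"
begin

text \<open>
  A finite multigraph (parallel edges and loops allowed) with vertex type \<open>'v\<close> and edge
  type \<open>'e\<close>, together with an orientation of its edges. Given lengths \<open>l\<close>, the edge \<open>e\<close> is
  identified with \<open>{0..l $ e}\<close>, where 0 corresponds to \<open>initial G e\<close> and \<open>l $ e\<close> to
  \<open>final G e\<close>.
\<close>

record ('v, 'e) oriented_graph =
  initial :: "'e \<Rightarrow> 'v"
  final :: "'e \<Rightarrow> 'v"

text \<open>
  \<open>val0 e\<close>, \<open>der0 e\<close> are the value and outward derivative (pointing from the vertex into the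
  edge) at the initial endpoint of \<open>e\<close>; \<open>val1 e\<close>, \<open>der1 e\<close> those at its final endpoint.
\<close>

definition kirchhoff ::
  "('v, 'e::finite) oriented_graph \<Rightarrow> ('e \<Rightarrow> complex) \<Rightarrow> ('e \<Rightarrow> complex) \<Rightarrow>
    ('e \<Rightarrow> complex) \<Rightarrow> ('e \<Rightarrow> complex) \<Rightarrow> bool" where
  "kirchhoff G val0 der0 val1 der1 \<longleftrightarrow>
    (\<forall>v. (\<exists>z. (\<forall>e. initial G e = v \<longrightarrow> val0 e = z) \<and> (\<forall>e. final G e = v \<longrightarrow> val1 e = z)) \<and>
         (\<Sum>e | initial G e = v. der0 e) + (\<Sum>e | final G e = v. der1 e) = 0)"

text \<open>
  \<open>u\<close> solves \<open>- \<Delta> u = lam u\<close>. Every \<open>H\<^sup>2\<close> solution has a smooth representative on each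
  closed edge, so the equation is stated classically, with one-sided derivatives at the
  endpoints. Only the values of \<open>u e\<close> on \<open>{0..l $ e}\<close> matter.
\<close>

definition laplace_eigen ::
  "('v, 'e::finite) oriented_graph \<Rightarrow> real ^ 'e \<Rightarrow> real \<Rightarrow> ('e \<Rightarrow> real \<Rightarrow> complex) \<Rightarrow> bool" where
  "laplace_eigen G l lam u \<longleftrightarrow>
    (\<exists>u'. (\<forall>e. \<forall>x\<in>{0..l $ e}.
             (u e has_vector_derivative u' e x) (at x within {0..l $ e}) \<and>
             (u' e has_vector_derivative - (complex_of_real lam * u e x)) (at x within {0..l $ e})) \<and>
          kirchhoff G (\<lambda>e. u e 0) (\<lambda>e. u' e 0) (\<lambda>e. u e (l $ e)) (\<lambda>e. - u' e (l $ e)))"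

definition observed_mass :: "('e::finite \<Rightarrow> real set) \<Rightarrow> ('e \<Rightarrow> real \<Rightarrow> complex) \<Rightarrow> real" where
  "observed_mass \<omega> u = (\<Sum>e\<in>UNIV. LINT x:\<omega> e|lebesgue. (cmod (u e x))\<^sup>2)"

definition L2_normalized :: "real ^ 'e::finite \<Rightarrow> ('e \<Rightarrow> real \<Rightarrow> complex) \<Rightarrow> bool" where
  "L2_normalized l u \<longleftrightarrow> sqrt (observed_mass (\<lambda>e. {0..l $ e}) u) = 1"

definition measurable_subset :: "real ^ 'e::finite \<Rightarrow> ('e \<Rightarrow> real set) \<Rightarrow> bool" where
  "measurable_subset l \<omega> \<longleftrightarrow> (\<forall>e. \<omega> e \<in> sets lebesgue \<and> \<omega> e \<subseteq> {0..l $ e})"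

definition edge_measures :: "('e::finite \<Rightarrow> real set) \<Rightarrow> real ^ 'e" where
  "edge_measures \<omega> = (\<chi> e. measure lebesgue (\<omega> e))"

text \<open>
  The infimum is taken in the extended reals, where it is \<open>\<infinity>\<close> for an empty set. It is
  nondecreasing in the spectral threshold, so the limit always exists.
\<close>

definition C_infty ::
  "('v, 'e::finite) oriented_graph \<Rightarrow> real ^ 'e \<Rightarrow> ('e \<Rightarrow> real set) \<Rightarrow> ereal" where
  "C_infty G l \<omega> =
    Lim at_top (\<lambda>L::real. Inf {ereal (observed_mass \<omega> u) | u lam.
      laplace_eigen G l lam u \<and> lam \<ge> L \<and> L2_normalized l u})"

text \<open>
  For \<open>k > 0\<close> and positive lengths, the coefficients \<open>A\<close>, \<open>B\<close> and hence the intensity \<open>q\<close>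
  are determined by \<open>u\<close>.
\<close>

definition has_intensity ::
  "real ^ 'e::finite \<Rightarrow> real \<Rightarrow> ('e \<Rightarrow> real \<Rightarrow> complex) \<Rightarrow> real ^ 'e \<Rightarrow> bool" where
  "has_intensity l k u q \<longleftrightarrow>
    (\<exists>A B :: 'e \<Rightarrow> complex.
      (\<forall>e. \<forall>x\<in>{0..l $ e}. u e x = A e * of_real (cos (k * x)) + B e * of_real (sin (k * x))) \<and>
      (\<forall>e. q $ e = ((cmod (A e))\<^sup>2 + (cmod (B e))\<^sup>2) / 2))"

definition limit_intensities ::
  "('v, 'e::finite) oriented_graph \<Rightarrow> real ^ 'e \<Rightarrow> (real ^ 'e) set" where
  "limit_intensities G l =
    {q. \<exists>(u :: nat \<Rightarrow> 'e \<Rightarrow> real \<Rightarrow> complex) (k :: nat \<Rightarrow> real) (p :: nat \<Rightarrow> real ^ 'e).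
      (\<forall>n. k n > 0 \<and> laplace_eigen G l ((k n)\<^sup>2) (u n) \<and> L2_normalized l (u n) \<and>
           has_intensity l (k n) (u n) (p n)) \<and>
      filterlim k at_top sequentially \<and> p \<longlonglongrightarrow> q}"

definition minimizing_intensity ::
  "('v, 'e::finite) oriented_graph \<Rightarrow> real ^ 'e \<Rightarrow> real ^ 'e \<Rightarrow> real ^ 'e \<Rightarrow> bool" where
  "minimizing_intensity G l \<alpha> q \<longleftrightarrow>
    q \<in> limit_intensities G l \<and> (\<forall>p\<in>limit_intensities G l. \<alpha> \<bullet> q \<le> \<alpha> \<bullet> p)"

text \<open>
  The family \<open>(A, B)\<close> is encoded as one vector \<open>c\<close> with \<open>A e = c $ Inl e\<close> and
  \<open>B e = c $ Inr e\<close>, so that \<open>vec.dim\<close> is the complex dimension.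
\<close>

definition phase_kernel ::
  "('v, 'e::finite) oriented_graph \<Rightarrow> real ^ 'e \<Rightarrow> (complex ^ ('e + 'e)) set" where
  "phase_kernel G \<theta> =
    {c. kirchhoff G
          (\<lambda>e. c $ Inl e)
          (\<lambda>e. c $ Inr e)
          (\<lambda>e. c $ Inl e * of_real (cos (\<theta> $ e)) + c $ Inr e * of_real (sin (\<theta> $ e)))
          (\<lambda>e. c $ Inl e * of_real (sin (\<theta> $ e)) - c $ Inr e * of_real (cos (\<theta> $ e)))}"

text \<open>
  The singular part of the determinant manifold in the torus of phases, given as its
  \<open>2 * pi\<close>-periodic preimage in Euclidean space; likewise the phase line modulo \<open>2 * pi\<close>
  is represented below by the ray \<open>k *\<^sub>R l\<close>.
\<close>

definition singular_part :: "('v, 'e::finite) oriented_graph \<Rightarrow> (real ^ 'e) set" where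
  "singular_part G = {\<theta>. vec.dim (phase_kernel G \<theta>) \<ge> 2}"

definition rationally_independent :: "real ^ 'e::finite \<Rightarrow> bool" where
  "rationally_independent l \<longleftrightarrow>
    (\<forall>r :: 'e \<Rightarrow> rat. (\<Sum>e\<in>UNIV. of_rat (r e) * l $ e) = 0 \<longrightarrow> (\<forall>e. r e = 0))"

definition generic_class :: "('v, 'e::finite) oriented_graph \<Rightarrow> (real ^ 'e) set" where
  "generic_class G =
    {l. (\<forall>e. l $ e > 0) \<and> rationally_independent l \<and> (\<forall>k>0. k *\<^sub>R l \<notin> singular_part G)}"

definition Theta3 :: "(2, 3) oriented_graph" where
  "Theta3 = \<lparr>initial = (\<lambda>_. 1), final = (\<lambda>_. 2)\<rparr>"

definition two_edge_cycles :: "('v, 'e) oriented_graph \<Rightarrow> 'e set set" where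
  "two_edge_cycles G =
    {{e, f} | e f. e \<noteq> f \<and> initial G e \<noteq> final G e \<and>
       {initial G e, final G e} = {initial G f, final G f}}"

text \<open>The primitive supports of \<open>Theta3\<close> are its two-edge cycles.\<close>

definition C_prim_Theta3 :: "real ^ 3 \<Rightarrow> real ^ 3 \<Rightarrow> real" where
  "C_prim_Theta3 l \<alpha> =
    Min ((\<lambda>P. (\<Sum>e\<in>P. \<alpha> $ e) / (\<Sum>e\<in>P. l $ e)) ` two_edge_cycles Theta3)"

definition edge_support :: "real ^ 'e::finite \<Rightarrow> 'e set" where
  "edge_support q = {e. q $ e \<noteq> 0}"

end

theory Submission
  imports Defs
begin

text \<open>
  On an eigenfunction of wavenumber \<open>k\<close>, write \<open>h\<^sub>e = k * l\<^sub>e / 2\<close> for the half phase of the edge \<open>e\<close>.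
  Expressed through the value and the derivative at the edge midpoints, the Kirchhoff conditions
  of the theta graph split into a part even and a part odd under the exchange of the two vertices.
  Rational independence of the lengths lets at most one of the numbers \<open>sin (2 * h\<^sub>e)\<close> vanish, and then
  only one of the two parts can be nonzero: the even one, with \<open>\<Sum> tan h\<^sub>e = 0\<close>, or the odd one, with
  \<open>\<Sum> cot h\<^sub>e = 0\<close>. In both cases the intensity has the form \<open>q\<^sub>e = r\<^sup>2 + s\<^sub>e\<^sup>2\<close> with real \<open>s\<^sub>e\<close> of sum
  zero (\<open>Theta3_kernel_intensity\<close>).

  For such a \<open>q\<close>, the excess of \<open>\<alpha> \<bullet> q\<close> over \<open>b c / (a b + a c + b c)\<close> times \<open>l \<bullet> q\<close> is a positive
  multiple of \<open>r\<^sup>2 (b\<^sup>2 + b c + c\<^sup>2) + (b s\<^sub>2 - c s\<^sub>3)\<^sup>2\<close> (\<open>observation_gap\<close>, \<open>defect_eq\<close>). This gives the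
  lower bound, and it shows that equality can only be reached in a limit where \<open>r\<close> tends to 0 and
  \<open>s\<close> becomes parallel to \<open>(- (b + c), c, b)\<close>, which determines the minimizing intensity up to scale.

  The limit is reached. By Kronecker's theorem the half phases \<open>(h\<^sub>e)\<close> come arbitrarily close
  modulo \<open>\<pi>\<close> to any target for arbitrarily large \<open>k\<close>, and as every \<open>tan h\<^sub>e\<close> increases in \<open>k\<close>, a small
  change of \<open>k\<close> makes \<open>\<Sum> tan h\<^sub>e\<close> exactly 0 (\<open>tan_sum_zero_near\<close>). Choosing the tangents close to
  \<open>n (- (b + c), c, b)\<close> with \<open>n\<close> growing produces eigenfunctions whose intensities converge to the
  minimizer (\<open>squares_in_limit_intensities\<close>).

  Masses are replaced by intensities throughout: on a whole edge, the mass of a wave differs from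
  \<open>l\<^sub>e * q\<^sub>e\<close> by a relative error \<open>O(1 / k)\<close>, and an edge observed up to a null set counts as a whole
  edge (\<open>observed_mass_approx_intensity\<close>).
\<close>

section \<open>Eigenvalues with prescribed phases\<close>

lemma rationally_independent_multiples:
  fixes l :: "real ^ 'e::finite"
  assumes "rationally_independent l" "e \<noteq> f" "of_int m * l $ e = of_int n * l $ f"
  shows "m = 0 \<and> n = 0"
proof -
  define r :: "'e \<Rightarrow> rat" where "r = (\<lambda>x. if x = e then of_int m else if x = f then - of_int n else 0)"
  have "(\<Sum>x\<in>UNIV. of_rat (r x) * l $ x) = (\<Sum>x\<in>{e, f}. of_rat (r x) * l $ x)"
    by (rule sum.mono_neutral_right) (auto simp: r_def)
  also have "\<dots> = 0"
    using assms(2,3) by (simp add: r_def of_rat_minus)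
  finally have "\<forall>x. r x = 0"
    using assms(1) unfolding rationally_independent_def by blast
  then show ?thesis
    using assms(2) by (metis (full_types) neg_equal_0_iff_equal of_int_eq_0_iff r_def)
qed

text \<open>
  Kronecker's theorem supplies one real \<open>t\<close>, possibly negative, with the required phases. Adding a
  large almost-period of all the phases, which simultaneous Dirichlet approximation provides, moves
  it beyond \<open>K\<close>.
\<close>

lemma phases_dense_for_large_k:
  fixes l :: "real ^ 'e::finite" and \<phi> :: "'e \<Rightarrow> real"
  assumes indep: "rationally_independent l" and "\<epsilon> > 0"
  obtains k m where "k > K" "\<And>e. \<bar>k * l $ e / 2 - of_int (m e) * pi - \<phi> e\<bar> < \<epsilon>"
proof -
  interpret module "\<lambda>r. (*) (real_of_int r)"
    by (simp add: module.intro distrib_left mult.commute)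
  define n where "n = CARD('e)"
  obtain g where g: "bij_betw g {..<n} (UNIV :: 'e set)"
    using ex_bij_betw_nat_finite[of "UNIV :: 'e set"] by (auto simp: n_def lessThan_atLeast0)
  define th where "th e = l $ e / (2 * pi)" for e
  have inj: "inj th"
  proof (rule injI, rule ccontr)
    fix e f assume "th e = th f" "e \<noteq> f"
    then show False
      using rationally_independent_multiples[OF indep, of e f 1 1] by (simp add: th_def)
  qed
  have img: "(th \<circ> g) ` {..<n} = range th"
    using g by (metis bij_betw_imp_surj_on image_comp)
  have ind: "independent ((th \<circ> g) ` {..<n})"
  proof -
    have False if u: "(\<Sum>v\<in>range th. real_of_int (u v) * v) = 0" "\<exists>v\<in>range th. u v \<noteq> 0" for u
    proof -
      have "0 = (\<Sum>e\<in>UNIV. real_of_int (u (th e)) * th e)"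
        using u(1) by (simp add: sum.reindex[OF inj])
      also have "\<dots> = (\<Sum>e\<in>UNIV. real_of_int (u (th e)) * l $ e) / (2 * pi)"
        by (simp add: th_def sum_divide_distrib)
      finally have "(\<Sum>e\<in>UNIV. of_rat (of_int (u (th e))) * l $ e) = 0"
        by simp
      then have "\<forall>e. rat_of_int (u (th e)) = 0"
        using indep[unfolded rationally_independent_def, THEN spec, of "\<lambda>e. of_int (u (th e))"]
        by (rule mp[rotated])
      with u(2) show False by auto
    qed
    then show ?thesis
      unfolding img by (subst dependent_finite) auto
  qed
  have injg: "inj_on (th \<circ> g) {..<n}"
    using g inj by (auto simp: bij_betw_def intro!: comp_inj_on intro: inj_on_subset)
  have "\<epsilon> / (2 * pi) > 0" using assms(2) by simp
  then obtain t h where th: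
    "\<And>i. i < n \<Longrightarrow> \<bar>t * (th \<circ> g) i - of_int (h i) - \<phi> (g i) / pi\<bar> < \<epsilon> / (2 * pi)"
    using Kronecker_thm_1[OF ind injg, of "\<epsilon> / (2 * pi)" "\<lambda>i. \<phi> (g i) / pi"] by blast
  \<comment> \<open>A positive integer multiple of \<open>M\<close> is large enough to carry \<open>t\<close> beyond \<open>K\<close>.\<close>
  define M where "M = \<bar>K\<bar> + \<bar>t\<bar> + 1"
  obtain N :: nat where N: "N > 0" "1 / N < \<epsilon> / (2 * pi)"
    using \<open>\<epsilon> / (2 * pi) > 0\<close> by (metis gr_zeroI inverse_eq_divide real_arch_inverse)
  obtain q p where q: "0 < q" and
    p: "\<And>i. i < n \<Longrightarrow> \<bar>of_int q * (M * (th \<circ> g) i) - of_int (p i)\<bar> < 1 / N"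
    using Dirichlet_approx_simult[OF N(1), of n "\<lambda>i. M * (th \<circ> g) i"] by metis
  define k where "k = t + of_int q * M"
  have "1 * M \<le> of_int q * M"
    using q by (intro mult_right_mono) (auto simp: M_def)
  then have "k > K"
    by (simp add: k_def M_def)
  moreover
  have "\<bar>k * l $ e / 2 - of_int (h i + p i) * pi - \<phi> e\<bar> < \<epsilon>"
    if i: "i < n" "g i = e" for i e
  proof -
    have "\<bar>k * th e - of_int (h i + p i) - \<phi> e / pi\<bar> < \<epsilon> / pi"
      using th[OF i(1)] p[OF i(1)] N(2) i(2) by (simp add: k_def algebra_simps)
    then have "\<bar>k * th e - of_int (h i + p i) - \<phi> e / pi\<bar> * pi < \<epsilon>"
      by (simp add: pos_less_divide_eq)
    also have "\<bar>k * th e - of_int (h i + p i) - \<phi> e / pi\<bar> * pi =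
        \<bar>(k * th e - of_int (h i + p i) - \<phi> e / pi) * pi\<bar>"
      by (simp add: abs_mult)
    also have "(k * th e - of_int (h i + p i) - \<phi> e / pi) * pi =
        k * l $ e / 2 - of_int (h i + p i) * pi - \<phi> e"
      by (simp add: th_def field_simps)
    finally show ?thesis .
  qed
  moreover have "e \<in> g ` {..<n}" for e
    using g by (simp add: bij_betw_def)
  then have "\<forall>e. \<exists>j. j < n \<and> g j = e"
    by (metis (no_types) imageE lessThan_iff)
  then obtain j where "\<forall>e. j e < n \<and> g (j e) = e"
    by metis
  ultimately show thesis
    by (intro that[of k "\<lambda>e. h (j e) + p (j e)"]) auto
qed

text \<open>
  Start from \<open>k0\<close> with half phases within \<open>\<delta>\<close> of \<open>arctan (t e)\<close> modulo \<open>pi\<close>. Moving \<open>k\<close> by \<open>\<eta>\<close> in either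
  direction shifts every half phase by at least \<open>\<delta>\<close>, so all tangents end on the same side of \<open>t e\<close>
  and their sum changes sign; \<open>\<eta>\<close> is small enough that no tangent leaves its branch or moves
  away from \<open>t e\<close> by \<open>\<rho>\<close>. The intermediate value theorem then gives the zero.
\<close>

lemma tan_sum_zero_near:
  fixes l :: "real ^ 'e::finite" and t :: "'e \<Rightarrow> real"
  assumes indep: "rationally_independent l" and pos: "\<And>e. l $ e > 0"
    and t: "(\<Sum>e\<in>UNIV. t e) = 0" and "\<rho> > 0"
  obtains k where "k > K" "\<And>e. cos (k * l $ e / 2) \<noteq> 0"
    "(\<Sum>e\<in>UNIV. tan (k * l $ e / 2)) = 0" "\<And>e. \<bar>tan (k * l $ e / 2) - t e\<bar> < \<rho>"
proof -
  define \<phi> where "\<phi> e = arctan (t e)" for e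
  define J where "J = {- (pi / 2)<..<pi / 2}"
  have "\<forall>\<^sub>F d in at_right 0. \<forall>s. \<bar>s\<bar> < d \<longrightarrow> \<phi> e + s \<in> J \<and> \<bar>tan (\<phi> e + s) - t e\<bar> < \<rho>" for e
  proof -
    have "\<forall>\<^sub>F y in nhds (\<phi> e). y \<in> J"
      unfolding J_def \<phi>_def
      by (intro eventually_nhds_in_open) (use arctan_bounded in auto)
    moreover have "isCont tan (\<phi> e)"
      by (simp add: \<phi>_def)
    then have "\<forall>\<^sub>F y in nhds (\<phi> e). dist (tan y) (tan (\<phi> e)) < \<rho>"
      using \<open>\<rho> > 0\<close> unfolding isCont_def tendsto_at_iff_tendsto_nhds by (rule tendstoD)
    ultimately have "\<forall>\<^sub>F y in nhds (\<phi> e). y \<in> J \<and> \<bar>tan y - t e\<bar> < \<rho>"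
      by eventually_elim (auto simp: dist_real_def \<phi>_def arctan)
    then obtain d where d: "d > 0" "\<And>y. dist y (\<phi> e) < d \<Longrightarrow> y \<in> J \<and> \<bar>tan y - t e\<bar> < \<rho>"
      unfolding eventually_nhds_metric by blast
    have "\<forall>\<^sub>F d' in at_right 0. d' < d"
      using d(1) by (auto simp: eventually_at_right_field) 
    then show ?thesis
      by eventually_elim (use d(2) in \<open>auto simp: dist_real_def\<close>)
  qed
  then have "\<forall>\<^sub>F d in at_right 0. \<forall>e s. \<bar>s\<bar> < d \<longrightarrow> \<phi> e + s \<in> J \<and> \<bar>tan (\<phi> e + s) - t e\<bar> < \<rho>"
    by (rule eventually_all_finite)
  then have "\<forall>\<^sub>F d::real in at_right 0. d > 0 \<and>
      (\<forall>e s. \<bar>s\<bar> < d \<longrightarrow> \<phi> e + s \<in> J \<and> \<bar>tan (\<phi> e + s) - t e\<bar> < \<rho>)"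
    using eventually_at_right_less[of "0::real"] by eventually_elim auto
  then obtain d where d: "d > 0"
    and near: "\<And>e s. \<bar>s\<bar> < d \<Longrightarrow> \<phi> e + s \<in> J \<and> \<bar>tan (\<phi> e + s) - t e\<bar> < \<rho>"
    using eventually_happens by force
  define L where "L = Max (range (($) l))"
  have L: "l $ e \<le> L" for e by (simp add: L_def)
  have "L > 0" using L[of undefined] pos[of undefined] by simp
  define \<eta> where "\<eta> = d / L"
  have "\<eta> > 0" using d \<open>L > 0\<close> by (simp add: \<eta>_def)
  have \<eta>: "\<eta> * l $ e \<le> d" for e
    using L[of e] \<open>L > 0\<close> d by (simp add: \<eta>_def divide_simps)
  define L' where "L' = Min (range (($) l))"
  have L': "L' \<le> l $ e" for e by (simp add: L'_def)
  have "L' > 0" using pos by (simp add: L'_def)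
  define \<delta> where "\<delta> = \<eta> * L' / 2"
  have "\<delta> > 0" using \<open>\<eta> > 0\<close> \<open>L' > 0\<close> by (simp add: \<delta>_def)
  have \<delta>: "\<delta> \<le> \<eta> * l $ e / 2" for e using L'[of e] \<open>\<eta> > 0\<close> by (simp add: \<delta>_def)
  obtain k0 m where "k0 > K + \<eta>"
    and m: "\<And>e. \<bar>k0 * l $ e / 2 - of_int (m e) * pi - \<phi> e\<bar> < \<delta>"
    using phases_dense_for_large_k[OF indep \<open>\<delta> > 0\<close>] by blast
  \<comment> \<open>The deviation of the half phase of \<open>e\<close> at \<open>k0 + x\<close> from its target.\<close>
  define s where "s e x = (k0 + x) * l $ e / 2 - of_int (m e) * pi - \<phi> e" for e x
  have s: "s e x = (k0 * l $ e / 2 - of_int (m e) * pi - \<phi> e) + x * l $ e / 2" for e x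
    by (simp add: s_def field_simps)
  have s_less: "\<bar>s e x\<bar> < d" if "\<bar>x\<bar> \<le> \<eta>" for e x
  proof -
    have "\<bar>x * l $ e / 2\<bar> \<le> \<eta> * l $ e / 2"
      using that pos[of e] by (simp add: abs_mult)
    then show ?thesis
      using m[of e] \<delta>[of e] \<eta>[of e] unfolding s by linarith
  qed
  define H where "H x = (\<Sum>e\<in>UNIV. tan (\<phi> e + s e x))" for x
  have tan_lt: "tan (\<phi> e + s e x) < tan (\<phi> e + s e y)"
    if "\<bar>s e x\<bar> < d" "\<bar>s e y\<bar> < d" "s e x < s e y" for e x y
    using near[OF that(1)] near[OF that(2)] that(3) unfolding J_def
    by (intro tan_monotone) (auto)
  have tan_\<phi>: "tan (\<phi> e) = t e" for e by (simp add: \<phi>_def arctan)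
  have Hpos: "H \<eta> > 0"
  proof -
    have "(\<Sum>e\<in>UNIV. t e) < H \<eta>"
      unfolding H_def
    proof (rule sum_strict_mono)
      fix e
      have "s e \<eta> > 0" using m[of e] \<delta>[of e] unfolding s by linarith
      then show "t e < tan (\<phi> e + s e \<eta>)"
        using near[of "s e \<eta>" e] near[of 0 e] s_less[of \<eta> e] d \<open>\<eta> > 0\<close> tan_\<phi>[of e]
          tan_monotone[of "\<phi> e" "\<phi> e + s e \<eta>"] by (simp add: J_def)
    qed auto
    then show ?thesis using t by simp
  qed
  have Hneg: "H (- \<eta>) < 0"
  proof -
    have "H (- \<eta>) < (\<Sum>e\<in>UNIV. t e)"
      unfolding H_def
    proof (rule sum_strict_mono)
      fix e
      have "s e (- \<eta>) < 0" using m[of e] \<delta>[of e] unfolding s by linarith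
      then show "tan (\<phi> e + s e (- \<eta>)) < t e"
        using near[of "s e (- \<eta>)" e] near[of 0 e] s_less[of "- \<eta>" e] d \<open>\<eta> > 0\<close> tan_\<phi>[of e]
          tan_monotone[of "\<phi> e + s e (- \<eta>)" "\<phi> e"] by (simp add: J_def)
    qed auto
    then show ?thesis using t by simp
  qed
  have cos_ne: "cos (\<phi> e + s e x) \<noteq> 0" if "\<bar>x\<bar> \<le> \<eta>" for e x
    using near[OF s_less[OF that, of e], of e] cos_gt_zero_pi[of "\<phi> e + s e x"]
    by (simp add: J_def)
  have "continuous_on {- \<eta>..\<eta>} H"
    unfolding H_def using cos_ne
    by (intro continuous_intros continuous_on_tan) (auto simp: s_def abs_le_iff intro!: continuous_intros)
  then obtain x where x: "- \<eta> \<le> x" "x \<le> \<eta>" "H x = 0"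
    using IVT'[of H "- \<eta>" 0 \<eta>] Hpos Hneg \<open>\<eta> > 0\<close> by auto
  then have ax: "\<bar>x\<bar> \<le> \<eta>" by simp
  have shift: "(k0 + x) * l $ e / 2 = (\<phi> e + s e x) + of_int (m e) * pi" for e
    by (simp add: s_def)
  have tan_shift: "tan ((k0 + x) * l $ e / 2) = tan (\<phi> e + s e x)" for e
    unfolding shift by (rule tan_periodic_int)
  show thesis
  proof (rule that)
    show "k0 + x > K" using \<open>k0 > K + \<eta>\<close> x by simp
    show "(\<Sum>e\<in>UNIV. tan ((k0 + x) * l $ e / 2)) = 0"
      using x(3) unfolding tan_shift H_def .
    show "\<bar>tan ((k0 + x) * l $ e / 2) - t e\<bar> < \<rho>" for e
      unfolding tan_shift using near[OF s_less[OF ax]] by blast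
    show "cos ((k0 + x) * l $ e / 2) \<noteq> 0" for e
    proof -
      have "cos (\<phi> e + s e x + of_int (m e) * pi) = cos (\<phi> e + s e x) * cos (of_int (m e) * pi)"
        using sin_zero_iff_int2 by (auto simp: cos_add)
      moreover have "sin (of_int (m e) * pi) = 0"
        using sin_zero_iff_int2 by blast
      then have "cos (of_int (m e) * pi) \<noteq> 0"
        using sin_cos_squared_add[of "of_int (m e) * pi"] by auto
      ultimately show ?thesis unfolding shift using cos_ne[OF ax] by simp
    qed
  qed
qed

section \<open>Eigenfunctions as trigonometric waves\<close>

definition wave :: "real \<Rightarrow> complex ^ ('e::finite + 'e) \<Rightarrow> 'e \<Rightarrow> real \<Rightarrow> complex" where
  "wave k c e x = c $ Inl e * of_real (cos (k * x)) + c $ Inr e * of_real (sin (k * x))"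

definition intensity :: "complex ^ ('e::finite + 'e) \<Rightarrow> real ^ 'e" where
  "intensity c = (\<chi> e. ((cmod (c $ Inl e))\<^sup>2 + (cmod (c $ Inr e))\<^sup>2) / 2)"

lemma has_intensity_iff:
  "has_intensity l k u q \<longleftrightarrow>
    (\<exists>c. (\<forall>e. \<forall>x\<in>{0..l $ e}. u e x = wave k c e x) \<and> q = intensity c)"
proof
  assume "has_intensity l k u q"
  then obtain A B where AB: "\<forall>e. \<forall>x\<in>{0..l $ e}. u e x = A e * of_real (cos (k * x)) + B e * of_real (sin (k * x))"
    "\<forall>e. q $ e = ((cmod (A e))\<^sup>2 + (cmod (B e))\<^sup>2) / 2"
    unfolding has_intensity_def by blast
  show "\<exists>c. (\<forall>e. \<forall>x\<in>{0..l $ e}. u e x = wave k c e x) \<and> q = intensity c"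
    using AB by (intro exI[of _ "\<chi> i. case_sum A B i"]) (simp add: wave_def intensity_def vec_eq_iff)
next
  assume "\<exists>c. (\<forall>e. \<forall>x\<in>{0..l $ e}. u e x = wave k c e x) \<and> q = intensity c"
  then obtain c where "\<forall>e. \<forall>x\<in>{0..l $ e}. u e x = wave k c e x" "q = intensity c"
    by blast
  then show "has_intensity l k u q"
    unfolding has_intensity_def
    by (intro exI[of _ "\<lambda>e. c $ Inl e"] exI[of _ "\<lambda>e. c $ Inr e"]) (simp add: wave_def intensity_def)
qed

text \<open>
  Ties the coefficients that occur in \<open>has_intensity\<close> to those obtained from the differential
  equation. An edge may be longer than a period, so the second coefficient is read off at a
  point of the first quarter period.
\<close>

lemma wave_unique:
  assumes "k > 0" "\<And>e. l $ e > 0" and eq: "\<And>e x. x \<in> {0..l $ e} \<Longrightarrow> wave k c e x = wave k d e x"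
  shows "c = d"
proof -
  have "c $ Inl e = d $ Inl e" for e
    using eq[of 0 e] assms(2)[of e] by (simp add: wave_def)
  moreover have "c $ Inr e = d $ Inr e" for e
  proof -
    define x where "x = min (l $ e) (pi / (2 * k))"
    have "x > 0" "x \<le> l $ e" "k * x \<le> pi / 2"
      using assms(1) assms(2)[of e] by (auto simp: x_def min_def field_simps)
    then have "sin (k * x) \<noteq> 0"
      using assms(1) sin_gt_zero[of "k * x"] by (smt (verit) mult_pos_pos pi_gt_zero pi_half_less_two field_sum_of_halves)
    with eq[of x e] \<open>x > 0\<close> \<open>x \<le> l $ e\<close> calculation[of e] show ?thesis
      by (simp add: wave_def)
  qed
  ultimately have "c $ i = d $ i" for i
    by (cases i) auto
  then show ?thesis by (simp add: vec_eq_iff)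
qed

lemma wave_solves_ode:
  fixes k :: real and c :: "complex ^ ('e::finite + 'e)" and e :: 'e
  defines "u' \<equiv> \<lambda>x. of_real k * (c $ Inr e * of_real (cos (k * x)) - c $ Inl e * of_real (sin (k * x)))"
  shows "(wave k c e has_vector_derivative u' x) (at x within S)"
    and "(u' has_vector_derivative - (complex_of_real (k\<^sup>2) * wave k c e x)) (at x within S)"
proof -
  have der: "((\<lambda>x. a * complex_of_real (cos (k * x)) + b * complex_of_real (sin (k * x))) has_vector_derivative
       of_real k * (b * of_real (cos (k * x)) - a * of_real (sin (k * x)))) (at x within S)" for a b
    by (rule derivative_eq_intros refl | simp add: scaleR_conv_of_real algebra_simps)+
  show "(wave k c e has_vector_derivative u' x) (at x within S)"
    unfolding wave_def[abs_def] u'_def by (rule der)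
  show "(u' has_vector_derivative - (complex_of_real (k\<^sup>2) * wave k c e x)) (at x within S)"
    using der[of "of_real k * c $ Inr e" "- of_real k * c $ Inl e"]
    unfolding wave_def u'_def by (simp add: algebra_simps power2_eq_square)
qed

text \<open>
  Rotating the phase vector \<open>(v, v' / k)\<close> back by the angle \<open>k * x\<close> gives the quantities \<open>f\<close> and \<open>g\<close> below,
  whose derivatives vanish.
\<close>

lemma ode_solution_is_trigonometric:
  fixes v v' :: "real \<Rightarrow> complex"
  assumes "k \<noteq> 0" "L \<ge> 0"
    and v: "\<And>x. x \<in> {0..L} \<Longrightarrow> (v has_vector_derivative v' x) (at x within {0..L})"
    and v': "\<And>x. x \<in> {0..L} \<Longrightarrow>
      (v' has_vector_derivative - (complex_of_real (k\<^sup>2) * v x)) (at x within {0..L})"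
    and x: "x \<in> {0..L}"
  shows "v x = v 0 * of_real (cos (k * x)) + v' 0 / of_real k * of_real (sin (k * x))"
    and "v' x = of_real k * (v' 0 / of_real k * of_real (cos (k * x)) - v 0 * of_real (sin (k * x)))"
proof -
  define f where "f x = v x * of_real (cos (k * x)) - v' x * of_real (sin (k * x) / k)" for x
  define g where "g x = v x * of_real (sin (k * x)) + v' x * of_real (cos (k * x) / k)" for x
  have cs: "((\<lambda>x. complex_of_real (cos (k * x))) has_vector_derivative of_real (- k * sin (k * x))) (at x within S)"
     "((\<lambda>x. complex_of_real (sin (k * x))) has_vector_derivative of_real (k * cos (k * x))) (at x within S)"
     "((\<lambda>x. complex_of_real (cos (k * x) / k)) has_vector_derivative of_real (- sin (k * x))) (at x within S)"
     "((\<lambda>x. complex_of_real (sin (k * x) / k)) has_vector_derivative of_real (cos (k * x))) (at x within S)"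
     for x S
    by (rule has_vector_derivative_of_real, use \<open>k \<noteq> 0\<close> in \<open>auto intro!: derivative_eq_intros\<close>)+
  have df: "(f has_vector_derivative 0) (at x within {0..L})" if "x \<in> {0..L}" for x
    unfolding f_def
    using has_vector_derivative_diff[OF has_vector_derivative_mult[OF v[OF that] cs(1)]
        has_vector_derivative_mult[OF v'[OF that] cs(4)]] \<open>k \<noteq> 0\<close>
    by (simp add: algebra_simps power2_eq_square)
  have dg: "(g has_vector_derivative 0) (at x within {0..L})" if "x \<in> {0..L}" for x
    unfolding g_def
    using has_vector_derivative_add[OF has_vector_derivative_mult[OF v[OF that] cs(2)]
        has_vector_derivative_mult[OF v'[OF that] cs(3)]] \<open>k \<noteq> 0\<close>
    by (simp add: algebra_simps power2_eq_square)
  obtain cf where cf: "\<And>x. x \<in> {0..L} \<Longrightarrow> f x = cf"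
    using has_vector_derivative_zero_constant[of "{0..L}" f] df by auto
  obtain cg where cg: "\<And>x. x \<in> {0..L} \<Longrightarrow> g x = cg"
    using has_vector_derivative_zero_constant[of "{0..L}" g] dg by auto
  have f: "f x = v 0" using cf[OF x] cf[of 0] \<open>L \<ge> 0\<close> by (simp add: f_def)
  have g: "g x = v' 0 / of_real k" using cg[OF x] cg[of 0] \<open>L \<ge> 0\<close> by (simp add: g_def)
  have one: "complex_of_real (cos (k * x)) * of_real (cos (k * x)) +
      of_real (sin (k * x)) * of_real (sin (k * x)) = 1"
    by (metis of_real_1 of_real_add of_real_mult power2_eq_square sin_cos_squared_add2)
  have "v x = f x * of_real (cos (k * x)) + g x * of_real (sin (k * x))"
  proof -
    have "f x * of_real (cos (k * x)) + g x * of_real (sin (k * x)) =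
      v x * (complex_of_real (cos (k * x)) * of_real (cos (k * x)) +
      of_real (sin (k * x)) * of_real (sin (k * x)))"
      unfolding f_def g_def of_real_divide by (simp add: algebra_simps)
    then show ?thesis unfolding one by simp
  qed
  then show "v x = v 0 * of_real (cos (k * x)) + v' 0 / of_real k * of_real (sin (k * x))"
    unfolding f g .
  have "v' x = of_real k * (g x * of_real (cos (k * x)) - f x * of_real (sin (k * x)))"
  proof -
    have "of_real k * (g x * of_real (cos (k * x)) - f x * of_real (sin (k * x))) =
      v' x * (complex_of_real (cos (k * x)) * of_real (cos (k * x)) +
      of_real (sin (k * x)) * of_real (sin (k * x)))"
      unfolding f_def g_def of_real_divide using \<open>k \<noteq> 0\<close> by (simp add: field_simps)
    then show ?thesis unfolding one by simp
  qed
  then show "v' x = of_real k * (v' 0 / of_real k * of_real (cos (k * x)) - v 0 * of_real (sin (k * x)))"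
    unfolding f g .
qed

lemma kirchhoff_scale_derivatives:
  assumes "a \<noteq> 0"
  shows "kirchhoff G v0 (\<lambda>e. a * d0 e) v1 (\<lambda>e. a * d1 e) \<longleftrightarrow> kirchhoff G v0 d0 v1 d1"
  using assms unfolding kirchhoff_def
  by (simp add: sum_distrib_left[symmetric] distrib_left[symmetric])

text \<open>
  The factor \<open>k\<close> by which the derivatives of a wave exceed the phase derivatives is common to all
  edges, so it drops out of the Kirchhoff condition and leaves the phase kernel at \<open>k *\<^sub>R l\<close>.
\<close>

lemma laplace_eigen_iff_wave:
  fixes l :: "real ^ 'e::finite"
  assumes "k > 0" and l: "\<And>e. l $ e > 0"
  shows "laplace_eigen G l (k\<^sup>2) u \<longleftrightarrow>
    (\<exists>c\<in>phase_kernel G (k *\<^sub>R l). \<forall>e. \<forall>x\<in>{0..l $ e}. u e x = wave k c e x)"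
proof
  assume "laplace_eigen G l (k\<^sup>2) u"
  then obtain u' where
    u: "\<And>e x. x \<in> {0..l $ e} \<Longrightarrow> (u e has_vector_derivative u' e x) (at x within {0..l $ e})" and
    u': "\<And>e x. x \<in> {0..l $ e} \<Longrightarrow>
      (u' e has_vector_derivative - (complex_of_real (k\<^sup>2) * u e x)) (at x within {0..l $ e})" and
    kh: "kirchhoff G (\<lambda>e. u e 0) (\<lambda>e. u' e 0) (\<lambda>e. u e (l $ e)) (\<lambda>e. - u' e (l $ e))"
    unfolding laplace_eigen_def by blast
  define c where "c = (\<chi> i. case i of Inl e \<Rightarrow> u e 0 | Inr e \<Rightarrow> u' e 0 / of_real k)"
  have uw: "u e x = wave k c e x"
    and uw': "u' e x = of_real k * (c $ Inr e * of_real (cos (k * x)) - c $ Inl e * of_real (sin (k * x)))"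
    if "x \<in> {0..l $ e}" for e x
    using ode_solution_is_trigonometric[OF _ _ u[of _ e] u'[of _ e] that] l[of e] \<open>k > 0\<close>
    by (simp_all add: wave_def c_def)
  have val: "u e (l $ e) = wave k c e (l $ e)" "u e 0 = c $ Inl e" for e
    using uw[of "l $ e" e] l[of e] by (simp_all add: c_def)
  have der: "u' e 0 = of_real k * c $ Inr e"
    "- u' e (l $ e) = of_real k * (c $ Inl e * of_real (sin (k * l $ e)) - c $ Inr e * of_real (cos (k * l $ e)))" for e
    using uw'[of "l $ e" e] l[of e] \<open>k > 0\<close> by (simp_all add: c_def algebra_simps)
  have "c \<in> phase_kernel G (k *\<^sub>R l)"
    using kh \<open>k > 0\<close> unfolding val der phase_kernel_def
    by (subst (asm) kirchhoff_scale_derivatives) (simp_all add: wave_def)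
  with uw show "\<exists>c\<in>phase_kernel G (k *\<^sub>R l). \<forall>e. \<forall>x\<in>{0..l $ e}. u e x = wave k c e x"
    by blast
next
  assume "\<exists>c\<in>phase_kernel G (k *\<^sub>R l). \<forall>e. \<forall>x\<in>{0..l $ e}. u e x = wave k c e x"
  then obtain c where c: "c \<in> phase_kernel G (k *\<^sub>R l)"
    and u: "\<And>e x. x \<in> {0..l $ e} \<Longrightarrow> u e x = wave k c e x" by blast
  define u' where "u' e x = of_real k * (c $ Inr e * of_real (cos (k * x)) - c $ Inl e * of_real (sin (k * x)))" for e x
  have val: "u e 0 = c $ Inl e" "u e (l $ e) = wave k c e (l $ e)" for e
    using u[of 0 e] u[of "l $ e" e] l[of e] by (simp_all add: wave_def)
  have der: "u' e 0 = of_real k * c $ Inr e"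
    "- u' e (l $ e) = of_real k * (c $ Inl e * of_real (sin (k * l $ e)) - c $ Inr e * of_real (cos (k * l $ e)))" for e
    by (simp_all add: u'_def algebra_simps)
  have "kirchhoff G (\<lambda>e. u e 0) (\<lambda>e. u' e 0) (\<lambda>e. u e (l $ e)) (\<lambda>e. - u' e (l $ e))"
    unfolding val der using c \<open>k > 0\<close> unfolding phase_kernel_def
    by (subst kirchhoff_scale_derivatives) (simp_all add: wave_def)
  moreover have "(u e has_vector_derivative u' e x) (at x within {0..l $ e})"
    "(u' e has_vector_derivative - (complex_of_real (k\<^sup>2) * u e x)) (at x within {0..l $ e})"
    if x: "x \<in> {0..l $ e}" for e x
  proof -
    have "(wave k c e has_vector_derivative u' e x) (at x within {0..l $ e})"
      unfolding u'_def by (rule wave_solves_ode)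
    then show "(u e has_vector_derivative u' e x) (at x within {0..l $ e})"
      by (rule has_vector_derivative_transform[OF x u, rotated])
    show "(u' e has_vector_derivative - (complex_of_real (k\<^sup>2) * u e x)) (at x within {0..l $ e})"
      unfolding u'_def[abs_def] u[OF x] by (rule wave_solves_ode)
  qed
  ultimately show "laplace_eigen G l (k\<^sup>2) u"
    unfolding laplace_eigen_def by blast
qed

section \<open>Intensities on the theta graph\<close>

lemma Theta3_kirchhoff_iff:
  "kirchhoff Theta3 v0 d0 v1 d1 \<longleftrightarrow>
    (\<exists>z. \<forall>e. v0 e = z) \<and> (\<exists>w. \<forall>e. v1 e = w) \<and> sum d0 UNIV = 0 \<and> sum d1 UNIV = 0"
proof -
  have "(2::2) \<noteq> 1" "(1::2) \<noteq> 2" by simp_all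
  then show ?thesis
    unfolding kirchhoff_def Theta3_def forall_2 oriented_graph.simps
    by auto
qed

text \<open>
  The case of a resonant edge: \<open>P\<close> stands for the midpoint values (or midpoint derivatives) and
  \<open>C\<close>, \<open>S\<close> for the cosines and sines of the half phases (or the reverse). If a single \<open>C e\<close> vanishes,
  then so does \<open>\<sigma>\<close>, hence \<open>P\<close> off \<open>e\<close>, and the sum condition removes the last value.
\<close>

lemma vanishing_factor_forces_zero:
  fixes P :: "'e::finite \<Rightarrow> complex" and C S :: "'e \<Rightarrow> real"
  assumes PC: "\<And>e. P e * of_real (C e) = \<sigma>" and PS: "(\<Sum>e\<in>UNIV. P e * of_real (S e)) = 0"
    and e: "C e = 0" "S e \<noteq> 0" and others: "\<And>f. f \<noteq> e \<Longrightarrow> C f \<noteq> 0"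
  shows "P f = 0"
proof -
  have "\<sigma> = 0" using PC[of e] e(1) by simp
  then have P: "P f = 0" if "f \<noteq> e" for f using PC[of f] others[OF that] by simp
  then have "(\<Sum>f\<in>UNIV. P f * of_real (S f)) = P e * of_real (S e)"
    by (subst sum.remove[of _ e]) auto
  then have "P e = 0" using PS e(2) by simp
  with P show ?thesis by (cases "f = e") auto
qed

text \<open>
  The witnesses are \<open>r = cmod \<sigma>\<close> and \<open>s e = r * (S e / C e)\<close>, where \<open>S e / C e\<close> is \<open>tan h\<^sub>e\<close> for the even and
  \<open>cot h\<^sub>e\<close> for the odd part. The factor \<open>r\<close> is kept in \<open>s\<close> so that \<open>\<sigma> = 0\<close> is covered too.
\<close>

lemma squared_moduli_from_common_product:
  fixes P :: "'e::finite \<Rightarrow> complex" and C S :: "'e \<Rightarrow> real"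
  assumes PC: "\<And>e. P e * of_real (C e) = \<sigma>" and PS: "(\<Sum>e\<in>UNIV. P e * of_real (S e)) = 0"
    and C: "\<And>e. C e \<noteq> 0" and CS: "\<And>e. (C e)\<^sup>2 + (S e)\<^sup>2 = 1"
  obtains r s where "(\<Sum>e\<in>UNIV. s e) = (0::real)" "\<And>e. (cmod (P e))\<^sup>2 = r\<^sup>2 + (s e)\<^sup>2"
proof
  let ?r = "cmod \<sigma>" and ?s = "\<lambda>e. cmod \<sigma> * (S e / C e)"
  have P: "P e = \<sigma> / of_real (C e)" for e using PC[of e] C[of e] by (simp add: field_simps)
  have "\<sigma> * of_real (\<Sum>e\<in>UNIV. S e / C e) = (\<Sum>e\<in>UNIV. P e * of_real (S e))"
    by (simp add: P sum_distrib_left)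
  then have "\<sigma> = 0 \<or> (\<Sum>e\<in>UNIV. S e / C e) = 0"
    using PS by (metis mult_eq_0_iff of_real_eq_0_iff)
  then have "cmod \<sigma> * (\<Sum>e\<in>UNIV. S e / C e) = 0"
    by auto
  then show "(\<Sum>e\<in>UNIV. ?s e) = 0"
    by (simp only: sum_distrib_left)
  show "(cmod (P e))\<^sup>2 = ?r\<^sup>2 + (?s e)\<^sup>2" for e
  proof -
    have "?r\<^sup>2 + (?s e)\<^sup>2 = ?r\<^sup>2 * ((C e)\<^sup>2 + (S e)\<^sup>2) / (C e)\<^sup>2"
      using C[of e] by (simp add: field_simps power2_eq_square)
    then show ?thesis unfolding CS P by (simp add: norm_divide power_divide)
  qed
qed

text \<open>
  Excludes that \<open>tan h\<^sub>e\<close> and \<open>cot h\<^sub>e\<close> both sum to zero: the second elementary symmetric function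
  of the \<open>x e\<close> would vanish with the first, so \<open>\<Sum> (x e)\<^sup>2\<close> would be 0.
\<close>

lemma sum_and_sum_inverse_nonzero:
  fixes x :: "3 \<Rightarrow> real"
  assumes "\<And>e. x e \<noteq> 0" "(\<Sum>e\<in>UNIV. x e) = 0" "(\<Sum>e\<in>UNIV. 1 / x e) = 0"
  shows False
proof -
  have "x 1 \<noteq> 0" "x 2 \<noteq> 0" "x 3 \<noteq> 0" using assms(1) by auto
  then have "x 2 * x 3 + x 1 * x 3 + x 1 * x 2 = 0"
    using assms(3) unfolding sum_3 by (simp add: field_simps)
  moreover have "(x 1 + x 2 + x 3)\<^sup>2 =
    (x 1)\<^sup>2 + (x 2)\<^sup>2 + (x 3)\<^sup>2 + 2 * (x 2 * x 3 + x 1 * x 3 + x 1 * x 2)"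
    by (simp add: power2_eq_square algebra_simps)
  ultimately have "(x 1)\<^sup>2 + (x 2)\<^sup>2 + (x 3)\<^sup>2 = 0"
    using assms(2) unfolding sum_3 by simp
  moreover have "(x 1)\<^sup>2 > 0" using \<open>x 1 \<noteq> 0\<close> by simp
  ultimately show False
    using zero_le_power2[of "x 2"] zero_le_power2[of "x 3"] by linarith
qed

text \<open>
  With \<open>P e\<close> and \<open>Q e\<close> the value and the derivative at the midpoint of \<open>e\<close>, the endpoint values are
  \<open>P e * C e \<minusplus> Q e * S e\<close> and the outward derivatives \<open>P e * S e \<plusminus> Q e * C e\<close>. Half sums and half
  differences of the vertex conditions therefore constrain \<open>P\<close> and \<open>Q\<close> separately, in the form
  treated by the three lemmas above.
\<close>

lemma Theta3_kernel_intensity: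
  assumes c: "c \<in> phase_kernel Theta3 \<theta>"
    and nonres: "\<And>e f. e \<noteq> f \<Longrightarrow> sin (\<theta> $ e) = 0 \<Longrightarrow> sin (\<theta> $ f) \<noteq> 0"
  obtains r s where "(\<Sum>e\<in>UNIV. s e) = (0::real)" "\<And>e. intensity c $ e = r\<^sup>2 + (s e)\<^sup>2"
proof -
  define C where "C e = cos (\<theta> $ e / 2)" for e
  define S where "S e = sin (\<theta> $ e / 2)" for e
  define P where "P e = c $ Inl e * of_real (C e) + c $ Inr e * of_real (S e)" for e
  define Q where "Q e = c $ Inr e * of_real (C e) - c $ Inl e * of_real (S e)" for e
  have CS: "(C e)\<^sup>2 + (S e)\<^sup>2 = 1" for e by (simp add: C_def S_def)
  have sin: "sin (\<theta> $ e) = 2 * S e * C e" and cos: "cos (\<theta> $ e) = (C e)\<^sup>2 - (S e)\<^sup>2" for e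
    using sin_double[of "\<theta> $ e / 2"] cos_double[of "\<theta> $ e / 2"] by (simp_all add: C_def S_def)
  have CS': "complex_of_real (C e) * of_real (C e) + of_real (S e) * of_real (S e) = 1" for e
    using CS[of e] by (metis of_real_1 of_real_add of_real_mult power2_eq_square)
  have Inl: "c $ Inl e = P e * of_real (C e) - Q e * of_real (S e)"
    and Inr: "c $ Inr e = P e * of_real (S e) + Q e * of_real (C e)" for e
  proof -
    have "P e * of_real (C e) - Q e * of_real (S e) =
      c $ Inl e * (complex_of_real (C e) * of_real (C e) + of_real (S e) * of_real (S e))"
      "P e * of_real (S e) + Q e * of_real (C e) =
      c $ Inr e * (complex_of_real (C e) * of_real (C e) + of_real (S e) * of_real (S e))"
      by (simp_all add: P_def Q_def algebra_simps)
    then show "c $ Inl e = P e * of_real (C e) - Q e * of_real (S e)"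
      "c $ Inr e = P e * of_real (S e) + Q e * of_real (C e)" unfolding CS' by simp_all
  qed
  have val: "c $ Inl e * of_real (cos (\<theta> $ e)) + c $ Inr e * of_real (sin (\<theta> $ e)) =
      P e * of_real (C e) + Q e * of_real (S e)"
    and der: "c $ Inl e * of_real (sin (\<theta> $ e)) - c $ Inr e * of_real (cos (\<theta> $ e)) =
      P e * of_real (S e) - Q e * of_real (C e)" for e
    by (simp_all add: sin cos P_def Q_def algebra_simps power2_eq_square)
  obtain z w where z: "\<And>e. P e * of_real (C e) - Q e * of_real (S e) = z"
    and w: "\<And>e. P e * of_real (C e) + Q e * of_real (S e) = w"
    and B: "(\<Sum>e\<in>UNIV. P e * of_real (S e) + Q e * of_real (C e)) = 0"
           "(\<Sum>e\<in>UNIV. P e * of_real (S e) - Q e * of_real (C e)) = 0"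
    using c unfolding phase_kernel_def mem_Collect_eq Theta3_kirchhoff_iff val der
    unfolding Inl Inr by blast
  define \<sigma> where "\<sigma> = (z + w) / 2"
  define \<delta> where "\<delta> = (w - z) / 2"
  have PC: "P e * of_real (C e) = \<sigma>" and QS: "Q e * of_real (S e) = \<delta>" for e
    unfolding \<sigma>_def \<delta>_def z[of e, symmetric] w[of e, symmetric] by (simp_all add: algebra_simps)
  have PS: "(\<Sum>e\<in>UNIV. P e * of_real (S e)) = 0" and QC: "(\<Sum>e\<in>UNIV. Q e * of_real (C e)) = 0"
    using B by (simp_all add: sum.distrib sum_subtractf)
  \<comment> \<open>Without a resonant edge, \<open>\<sigma>\<close> and \<open>\<delta>\<close> both nonzero would make the tangents and the cotangents
    of the half phases sum to zero simultaneously.\<close>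
  have "(\<forall>e. C e \<noteq> 0 \<and> Q e = 0) \<or> (\<forall>e. S e \<noteq> 0 \<and> P e = 0)"
  proof -
    consider e where "C e = 0" | e where "S e = 0" | "\<forall>e. C e \<noteq> 0 \<and> S e \<noteq> 0" by blast
    then show ?thesis
    proof cases
      case (1 e)
      have S: "S e \<noteq> 0" using CS[of e] 1 by auto
      have f: "C f \<noteq> 0 \<and> S f \<noteq> 0" if "f \<noteq> e" for f
        using nonres[of e f] that 1 by (auto simp: sin)
      have "P f = 0" for f
        using vanishing_factor_forces_zero[OF PC PS 1 S] f by blast
      moreover have "S f \<noteq> 0" for f using S f by (cases "f = e") auto
      ultimately show ?thesis by blast
    next
      case (2 e)
      have C: "C e \<noteq> 0" using CS[of e] 2 by auto
      have f: "C f \<noteq> 0 \<and> S f \<noteq> 0" if "f \<noteq> e" for f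
        using nonres[of e f] that 2 by (auto simp: sin)
      have "Q f = 0" for f
        using vanishing_factor_forces_zero[OF QS QC 2 C] f by blast
      moreover have "C f \<noteq> 0" for f using C f by (cases "f = e") auto
      ultimately show ?thesis by blast
    next
      case 3
      have "\<sigma> = 0 \<or> \<delta> = 0"
      proof (rule ccontr)
        assume nz: "\<not> (\<sigma> = 0 \<or> \<delta> = 0)"
        have "P e = \<sigma> / of_real (C e)" "Q e = \<delta> / of_real (S e)" for e
          using PC[of e] QS[of e] 3 by (simp_all add: field_simps)
        then have "\<sigma> * of_real (\<Sum>e\<in>UNIV. S e / C e) = 0" "\<delta> * of_real (\<Sum>e\<in>UNIV. C e / S e) = 0"
          using PS QC by (simp_all add: sum_distrib_left)
        then have "(\<Sum>e\<in>UNIV. S e / C e) = 0" "(\<Sum>e\<in>UNIV. 1 / (S e / C e)) = 0"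
          using nz unfolding mult_eq_0_iff of_real_eq_0_iff by auto
        with 3 show False
          by (intro sum_and_sum_inverse_nonzero[of "\<lambda>e. S e / C e"]) auto
      qed
      then show ?thesis using PC QS 3 by (metis mult_eq_0_iff of_real_eq_0_iff)
    qed
  qed
  then show thesis
  proof
    assume Q: "\<forall>e. C e \<noteq> 0 \<and> Q e = 0"
    obtain r s where rs: "(\<Sum>e\<in>UNIV. s e) = (0::real)" "\<And>e. (cmod (P e))\<^sup>2 = r\<^sup>2 + (s e)\<^sup>2"
      using squared_moduli_from_common_product[OF PC PS _ CS] Q by metis
    have "intensity c $ e = (cmod (P e))\<^sup>2 * ((C e)\<^sup>2 + (S e)\<^sup>2) / 2" for e
      using Q by (simp add: intensity_def Inl Inr norm_mult power_mult_distrib algebra_simps)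
    then have "intensity c $ e = (r / sqrt 2)\<^sup>2 + (s e / sqrt 2)\<^sup>2" for e
      unfolding CS rs by (simp add: power_divide add_divide_distrib)
    moreover have "(\<Sum>e\<in>UNIV. s e / sqrt 2) = 0"
      using rs(1) by (simp add: sum_divide_distrib[symmetric])
    ultimately show thesis by (rule that[rotated])
  next
    assume P: "\<forall>e. S e \<noteq> 0 \<and> P e = 0"
    have SC: "(S e)\<^sup>2 + (C e)\<^sup>2 = 1" for e using CS[of e] by simp
    obtain r s where rs: "(\<Sum>e\<in>UNIV. s e) = (0::real)" "\<And>e. (cmod (Q e))\<^sup>2 = r\<^sup>2 + (s e)\<^sup>2"
      using squared_moduli_from_common_product[OF QS QC _ SC] P by metis
    have "intensity c $ e = (cmod (Q e))\<^sup>2 * ((C e)\<^sup>2 + (S e)\<^sup>2) / 2" for e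
      using P by (simp add: intensity_def Inl Inr norm_mult power_mult_distrib algebra_simps)
    then have "intensity c $ e = (r / sqrt 2)\<^sup>2 + (s e / sqrt 2)\<^sup>2" for e
      unfolding CS rs by (simp add: power_divide add_divide_distrib)
    moreover have "(\<Sum>e\<in>UNIV. s e / sqrt 2) = 0"
      using rs(1) by (simp add: sum_divide_distrib[symmetric])
    ultimately show thesis by (rule that[rotated])
  qed
qed

text \<open>
  On each edge this is the wave symmetric about the midpoint with value \<open>r\<close> at both ends; its outward
  derivative is \<open>r * tan (\<theta> $ e / 2)\<close> at both ends, so both vertices impose the same condition.
\<close>

lemma even_wave_in_Theta3_kernel:
  fixes \<theta> :: "real ^ 3"
  assumes "\<And>e. cos (\<theta> $ e / 2) \<noteq> 0" "(\<Sum>e\<in>UNIV. tan (\<theta> $ e / 2)) = 0"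
  shows "(\<chi> i. of_real (case i of Inl e \<Rightarrow> r | Inr e \<Rightarrow> r * tan (\<theta> $ e / 2))) \<in> phase_kernel Theta3 \<theta>"
    (is "?c \<in> _")
proof -
  let ?h = "\<lambda>e. \<theta> $ e / 2"
  have tc: "tan (?h e) * cos (?h e) = sin (?h e)" for e using assms(1)[of e] by (simp add: tan_def)
  have *: "sin (\<theta> $ e) = 2 * sin (?h e) * cos (?h e)" "cos (\<theta> $ e) = 1 - 2 * (sin (?h e))\<^sup>2"
    "cos (\<theta> $ e) = 2 * (cos (?h e))\<^sup>2 - 1" for e
    using sin_double[of "?h e"] cos_double_sin[of "?h e"] cos_double_cos[of "?h e"] by simp_all
  have val: "cos (\<theta> $ e) + tan (?h e) * sin (\<theta> $ e) = 1" for e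
  proof -
    have "tan (?h e) * sin (\<theta> $ e) = 2 * sin (?h e) * (tan (?h e) * cos (?h e))" unfolding * by simp
    then show ?thesis unfolding tc by (simp add: *(2) power2_eq_square)
  qed
  have der: "sin (\<theta> $ e) - tan (?h e) * cos (\<theta> $ e) = tan (?h e)" for e
  proof -
    have "tan (?h e) * cos (\<theta> $ e) = 2 * cos (?h e) * (tan (?h e) * cos (?h e)) - tan (?h e)"
      unfolding *(3) by (simp add: algebra_simps power2_eq_square)
    then show ?thesis unfolding tc by (simp add: *(1))
  qed
  have "?c $ Inl e * of_real (cos (\<theta> $ e)) + ?c $ Inr e * of_real (sin (\<theta> $ e)) = complex_of_real r" for e
  proof -
    have "?c $ Inl e * of_real (cos (\<theta> $ e)) + ?c $ Inr e * of_real (sin (\<theta> $ e)) =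
      complex_of_real (r * (cos (\<theta> $ e) + tan (?h e) * sin (\<theta> $ e)))"
      by (simp add: algebra_simps)
    then show ?thesis unfolding val by simp
  qed
  moreover have "?c $ Inl e * of_real (sin (\<theta> $ e)) - ?c $ Inr e * of_real (cos (\<theta> $ e)) =
      complex_of_real (r * tan (?h e))" for e
  proof -
    have "?c $ Inl e * of_real (sin (\<theta> $ e)) - ?c $ Inr e * of_real (cos (\<theta> $ e)) =
      complex_of_real (r * (sin (\<theta> $ e) - tan (?h e) * cos (\<theta> $ e)))"
      by (simp add: algebra_simps)
    then show ?thesis unfolding der .
  qed
  moreover have "(\<Sum>e\<in>UNIV. complex_of_real (r * tan (?h e))) = 0"
    using assms(2) by (metis of_real_0 of_real_sum mult_zero_right sum_distrib_left)
  ultimately show ?thesis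
    unfolding phase_kernel_def mem_Collect_eq Theta3_kirchhoff_iff by simp
qed

text \<open>
  Two edges resonant at the same \<open>k\<close> would have lengths in a rational ratio, so a phase on
  the ray \<open>k *\<^sub>R l\<close> meets the nonresonance condition of \<open>Theta3_kernel_intensity\<close>.
\<close>

lemma Theta3_eigenfunction_intensity:
  fixes l :: "real ^ 3"
  assumes pos: "\<And>e. l $ e > 0" and indep: "rationally_independent l" and "k > 0"
    and u: "laplace_eigen Theta3 l (k\<^sup>2) u" "has_intensity l k u q"
  obtains r s where "(\<Sum>e\<in>UNIV. s e) = (0::real)" "\<And>e. q $ e = r\<^sup>2 + (s e)\<^sup>2"
proof -
  obtain c where c: "c \<in> phase_kernel Theta3 (k *\<^sub>R l)"
    and uc: "\<And>e x. x \<in> {0..l $ e} \<Longrightarrow> u e x = wave k c e x"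
    using u(1) laplace_eigen_iff_wave[OF \<open>k > 0\<close> pos] by blast
  obtain d where ud: "\<And>e x. x \<in> {0..l $ e} \<Longrightarrow> u e x = wave k d e x" and q: "q = intensity d"
    using u(2) unfolding has_intensity_iff by blast
  have "c = d"
    by (rule wave_unique[of k l, OF \<open>k > 0\<close> pos]) (simp add: uc[symmetric] ud[symmetric])
  have nonres: "sin ((k *\<^sub>R l) $ f) \<noteq> 0" if "e \<noteq> f" "sin ((k *\<^sub>R l) $ e) = 0" for e f
  proof
    assume "sin ((k *\<^sub>R l) $ f) = 0"
    with that(2) obtain m n where mn: "k * l $ e = of_int m * pi" "k * l $ f = of_int n * pi"
      by (auto simp: sin_zero_iff_int2)
    have "of_int n * (k * l $ e) = of_int m * (k * l $ f)"
      unfolding mn by simp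
    then have "of_int n * l $ e = of_int m * l $ f"
      using \<open>k > 0\<close> by (simp add: mult.left_commute[of _ k])
    then have "n = 0"
      using rationally_independent_multiples[OF indep that(1), of n m] by simp
    with mn(2) show False
      using pos[of f] \<open>k > 0\<close> by simp
  qed
  show thesis
    by (rule Theta3_kernel_intensity[OF c]) (use nonres that in \<open>auto simp: q \<open>c = d\<close>\<close>)
qed

section \<open>Mass and intensity\<close>

text \<open>
  The mean of \<open>(cmod (wave k c e x))\<^sup>2\<close> over a period is the intensity; the remainder oscillates with
  frequency \<open>2 * k\<close> and integrates to \<open>O(1 / k)\<close>. The function \<open>F\<close> below is an explicit antiderivative.
\<close>

lemma wave_mass_Icc:
  assumes "L > 0" "k > 0"
  shows "\<bar>(LINT x:{0..L}|lebesgue. (cmod (wave k c e x))\<^sup>2) - L * intensity c $ e\<bar>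
    \<le> 3 / (2 * k) * intensity c $ e"
proof -
  define A where "A = c $ Inl e"
  define B where "B = c $ Inr e"
  define a where "a = (cmod A)\<^sup>2"
  define b where "b = (cmod B)\<^sup>2"
  define d where "d = Re (A * cnj B)"
  define F where "F x = a * (x / 2 + sin (k * x) * cos (k * x) / (2 * k)) +
     b * (x / 2 - sin (k * x) * cos (k * x) / (2 * k)) + d * ((sin (k * x))\<^sup>2 / k)" for x
  have wave: "(cmod (wave k c e x))\<^sup>2 =
     a * (cos (k * x))\<^sup>2 + b * (sin (k * x))\<^sup>2 + d * (2 * sin (k * x) * cos (k * x))" for x
    unfolding wave_def a_def b_def d_def A_def[symmetric] B_def[symmetric]
    unfolding cmod_power2
    by (simp add: power2_eq_square algebra_simps)
  have F: "(F has_vector_derivative (cmod (wave k c e x))\<^sup>2) (at x within S)" for x S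
  proof -
    have c2: "(cos (k * x))\<^sup>2 = 1 - (sin (k * x))\<^sup>2" by (simp add: cos_squared_eq)
    have sc: "((\<lambda>x. sin (k * x) * cos (k * x) / (2 * k)) has_real_derivative
        ((cos (k * x))\<^sup>2 - (sin (k * x))\<^sup>2) / 2) (at x within S)"
      using \<open>k > 0\<close> by (auto intro!: derivative_eq_intros simp: field_simps power2_eq_square)
    have s2: "((\<lambda>x. (sin (k * x))\<^sup>2 / k) has_real_derivative 2 * sin (k * x) * cos (k * x)) (at x within S)"
      using \<open>k > 0\<close> by (auto intro!: derivative_eq_intros simp: field_simps)
    have id: "((\<lambda>x. x / 2) has_real_derivative 1 / 2) (at x within S)"
      by (auto intro!: derivative_eq_intros)
    have "(F has_real_derivative (cmod (wave k c e x))\<^sup>2) (at x within S)"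
      unfolding F_def wave
      by (rule DERIV_cong[OF DERIV_add[OF DERIV_add[OF
            DERIV_cmult[OF DERIV_add[OF id sc]] DERIV_cmult[OF DERIV_diff[OF id sc]]] DERIV_cmult[OF s2]]])
        (simp add: c2 field_simps)
    then show ?thesis by (simp add: has_real_derivative_iff_has_vector_derivative)
  qed
  have cont: "continuous_on UNIV (\<lambda>x. (cmod (wave k c e x))\<^sup>2)"
    unfolding wave by (intro continuous_intros)
  have "(LINT x:{0..L}|lebesgue. (cmod (wave k c e x))\<^sup>2) =
      (LINT x|lborel. indicator {0..L} x *\<^sub>R (cmod (wave k c e x))\<^sup>2)"
    unfolding set_lebesgue_integral_def
    by (rule integral_completion) (use borel_measurable_continuous_onI[OF cont] in measurable)
  also have "\<dots> = F L - F 0"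
    using \<open>L > 0\<close> F cont by (intro integral_FTC_atLeastAtMost) (auto intro: continuous_on_subset)
  finally have int: "(LINT x:{0..L}|lebesgue. (cmod (wave k c e x))\<^sup>2) = F L - F 0" .
  have q: "intensity c $ e = (a + b) / 2"
    by (simp add: intensity_def a_def b_def A_def B_def)
  have diff: "F L - F 0 - L * intensity c $ e =
     ((a - b) * (sin (k * L) * cos (k * L)) + d * (2 * (sin (k * L))\<^sup>2)) / (2 * k)"
    unfolding q F_def using \<open>k > 0\<close> by (simp add: field_simps)
  have a0: "a \<ge> 0" "b \<ge> 0" by (simp_all add: a_def b_def)
  have "\<bar>d\<bar> \<le> cmod A * cmod B"
    unfolding d_def using abs_Re_le_cmod[of "A * cnj B"] by (simp add: norm_mult)
  also have "\<dots> \<le> (a + b) / 2"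
    using sum_squares_bound[of "cmod A" "cmod B"] by (simp add: a_def b_def)
  finally have d: "\<bar>d\<bar> \<le> (a + b) / 2" .
  have sc: "\<bar>sin (k * L) * cos (k * L)\<bar> \<le> 1 / 2"
    using sum_squares_bound[of "\<bar>sin (k * L)\<bar>" "\<bar>cos (k * L)\<bar>"] by (simp add: abs_mult)
  have s2: "\<bar>2 * (sin (k * L))\<^sup>2\<bar> \<le> 2"
    using abs_sin_le_one[of "k * L"] by (simp add: abs_square_le_1)
  have "\<bar>(a - b) * (sin (k * L) * cos (k * L)) + d * (2 * (sin (k * L))\<^sup>2)\<bar> \<le>
     \<bar>a - b\<bar> * \<bar>sin (k * L) * cos (k * L)\<bar> + \<bar>d\<bar> * \<bar>2 * (sin (k * L))\<^sup>2\<bar>"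
    by (metis abs_mult abs_triangle_ineq)
  also have "\<dots> \<le> (a + b) * (1 / 2) + (a + b) / 2 * 2"
    using a0 by (intro add_mono mult_mono sc s2 d) auto
  finally have "\<bar>(a - b) * (sin (k * L) * cos (k * L)) + d * (2 * (sin (k * L))\<^sup>2)\<bar> \<le> 3 * ((a + b) / 2)"
    by linarith
  moreover have "\<bar>2 * k\<bar> = 2 * k" "0 \<le> 2 * k" using \<open>k > 0\<close> by simp_all
  ultimately have "\<bar>F L - F 0 - L * intensity c $ e\<bar> \<le> 3 * ((a + b) / 2) / (2 * k)"
    unfolding diff abs_divide by (simp only: divide_right_mono)
  then show ?thesis unfolding int q by simp
qed

lemma wave_mass_full_or_null:
  assumes "L > 0" "W \<in> sets lebesgue" "W \<subseteq> {0..L}" "measure lebesgue W = \<alpha>" "\<alpha> = 0 \<or> \<alpha> = L"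
  shows "(LINT x:W|lebesgue. (cmod (wave k c e x))\<^sup>2) =
    (\<alpha> / L) * (LINT x:{0..L}|lebesgue. (cmod (wave k c e x))\<^sup>2)"
proof -
  let ?f = "\<lambda>x. (cmod (wave k c e x))\<^sup>2"
  have cont: "continuous_on UNIV ?f"
    unfolding wave_def by (intro continuous_intros)
  have "?f \<in> borel_measurable lborel"
    using borel_measurable_continuous_onI[OF cont] by simp
  then have [measurable]: "?f \<in> borel_measurable lebesgue"
    by (rule measurable_completion)
  have meas: "set_borel_measurable lebesgue X ?f" if "X \<in> sets lebesgue" for X
    unfolding set_borel_measurable_def using that by measurable
  have W: "W \<in> lmeasurable"
    by (rule bounded_set_imp_lmeasurable) (use assms(2) bounded_subset[OF bounded_closed_interval assms(3)] in auto)
  show ?thesis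
    using assms(5)
  proof
    assume "\<alpha> = 0"
    then have "W \<in> null_sets lebesgue"
      using W assms(4) by (simp add: fmeasurableD2 measure_eq_0_null_sets[symmetric] null_sets_def
        emeasure_eq_measure2)
    then have "AE x in lebesgue. x \<in> {} \<longleftrightarrow> x \<in> W" by (auto dest: AE_not_in)
    then have "(LINT x:W|lebesgue. ?f x) = (LINT x:{}|lebesgue. ?f x)"
      by (intro set_integral_cong_set meas assms(2)) auto
    then show ?thesis using \<open>\<alpha> = 0\<close> by (simp add: set_lebesgue_integral_def)
  next
    assume "\<alpha> = L"
    then have "measure lebesgue ({0..L} - W) = 0"
      using W assms(1,3,4) by (subst measurable_measure_Diff) auto
    moreover have "{0..L} - W \<in> lmeasurable" using W by auto
    ultimately have "{0..L} - W \<in> null_sets lebesgue"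
      by (simp add: null_sets_def emeasure_eq_measure2 fmeasurableD)
    then have "AE x in lebesgue. x \<notin> {0..L} - W" by (rule AE_not_in)
    then have "AE x in lebesgue. x \<in> {0..L} \<longleftrightarrow> x \<in> W"
      by eventually_elim (use assms(3) in auto)
    then have "(LINT x:W|lebesgue. ?f x) = (LINT x:{0..L}|lebesgue. ?f x)"
      by (intro set_integral_cong_set meas assms(2)) auto
    then show ?thesis using \<open>\<alpha> = L\<close> \<open>L > 0\<close> by simp
  qed
qed

text \<open>
  The error is stated relative to the main term, with the shortest edge absorbed in \<open>D\<close>, so that
  it passes through ratios of masses without a separate bound on the intensities.
\<close>

lemma observed_mass_approx_intensity:
  fixes l :: "real ^ 'e::finite"
  assumes l: "\<And>e. l $ e > 0"
  obtains D where "D \<ge> 0"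
    "\<And>k u q \<omega>. \<lbrakk>k > 0; has_intensity l k u q; measurable_subset l \<omega>;
       \<And>e. edge_measures \<omega> $ e = 0 \<or> edge_measures \<omega> $ e = l $ e\<rbrakk> \<Longrightarrow>
       \<bar>observed_mass \<omega> u - edge_measures \<omega> \<bullet> q\<bar> \<le> D / k * (edge_measures \<omega> \<bullet> q)"
    "\<And>k u q. \<lbrakk>k > 0; has_intensity l k u q; L2_normalized l u\<rbrakk> \<Longrightarrow> \<bar>1 - l \<bullet> q\<bar> \<le> D / k * (l \<bullet> q)"
proof -
  define L where "L = Min (range (($) l))"
  have L: "L \<le> l $ e" for e by (simp add: L_def)
  have "L > 0" using l by (simp add: L_def)
  define D where "D = 3 / (2 * L)"
  have mass: "\<bar>observed_mass \<omega> u - edge_measures \<omega> \<bullet> q\<bar> \<le> D / k * (edge_measures \<omega> \<bullet> q)"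
    if "k > 0" and u: "has_intensity l k u q" and \<omega>: "measurable_subset l \<omega>"
      and fn: "\<And>e. edge_measures \<omega> $ e = 0 \<or> edge_measures \<omega> $ e = l $ e" for k u q \<omega>
  proof -
    obtain c where uw: "\<And>e x. x \<in> {0..l $ e} \<Longrightarrow> u e x = wave k c e x" and q: "q = intensity c"
      using u unfolding has_intensity_iff by blast
    let ?\<alpha> = "edge_measures \<omega>"
    let ?m = "\<lambda>e W. LINT x:W|lebesgue. (cmod (wave k c e x))\<^sup>2"
    have \<omega>e: "\<omega> e \<in> sets lebesgue" "\<omega> e \<subseteq> {0..l $ e}" for e
      using \<omega> by (auto simp: measurable_subset_def)
    have q0: "q $ e \<ge> 0" for e by (simp add: q intensity_def)
    have \<alpha>0: "?\<alpha> $ e \<ge> 0" for e by (simp add: edge_measures_def)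
    have "observed_mass \<omega> u = (\<Sum>e\<in>UNIV. ?m e (\<omega> e))"
      unfolding observed_mass_def
      by (intro sum.cong set_lebesgue_integral_cong) (use \<omega>e uw in \<open>auto simp: subset_iff\<close>)
    also have "\<dots> = (\<Sum>e\<in>UNIV. (?\<alpha> $ e / l $ e) * ?m e {0..l $ e})"
      by (intro sum.cong wave_mass_full_or_null refl l \<omega>e fn) (simp add: edge_measures_def)
    finally have "observed_mass \<omega> u - ?\<alpha> \<bullet> q =
        (\<Sum>e\<in>UNIV. (?\<alpha> $ e / l $ e) * (?m e {0..l $ e} - l $ e * q $ e))"
      using l by (simp add: inner_vec_def sum_subtractf algebra_simps less_imp_neq[symmetric])
    also have "\<bar>\<dots>\<bar> \<le> (\<Sum>e\<in>UNIV. D / k * (?\<alpha> $ e * q $ e))"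
    proof (rule order_trans[OF sum_abs sum_mono])
      fix e
      have "\<bar>(?\<alpha> $ e / l $ e) * (?m e {0..l $ e} - l $ e * q $ e)\<bar> =
          (?\<alpha> $ e / l $ e) * \<bar>?m e {0..l $ e} - l $ e * q $ e\<bar>"
        using \<alpha>0[of e] l[of e] by (simp add: abs_mult)
      also have "\<dots> \<le> (?\<alpha> $ e / L) * (3 / (2 * k) * q $ e)"
        using \<alpha>0[of e] l[of e] L[of e] \<open>L > 0\<close> \<open>k > 0\<close> unfolding q
        by (intro mult_mono wave_mass_Icc divide_left_mono) auto
      finally show "\<bar>(?\<alpha> $ e / l $ e) * (?m e {0..l $ e} - l $ e * q $ e)\<bar> \<le> D / k * (?\<alpha> $ e * q $ e)"
        by (simp add: D_def)
    qed
    finally show ?thesis by (simp add: inner_vec_def sum_distrib_left)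
  qed
  \<comment> \<open>The total mass is the special case in which everything is observed.\<close>
  have "\<bar>1 - l \<bullet> q\<bar> \<le> D / k * (l \<bullet> q)"
    if "k > 0" and u: "has_intensity l k u q" and n: "L2_normalized l u" for k u q
  proof -
    have em: "edge_measures (\<lambda>e. {0..l $ e}) = l"
      using l by (simp add: edge_measures_def vec_eq_iff less_imp_le)
    have "observed_mass (\<lambda>e. {0..l $ e}) u = 1"
      using n by (simp add: L2_normalized_def)
    moreover have "measurable_subset l (\<lambda>e. {0..l $ e})"
      by (simp add: measurable_subset_def)
    ultimately show ?thesis
      using mass[OF that(1,2), of "\<lambda>e. {0..l $ e}"] unfolding em by simp
  qed
  moreover have "D \<ge> 0" using \<open>L > 0\<close> by (simp add: D_def)
  ultimately show thesis using that mass by blast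
qed

section \<open>The quadratic form controlling the observation\<close>

text \<open>
  Up to a positive factor, \<open>defect b c q\<close> is the excess of the observed mass over the claimed
  minimal proportion of the total mass; see \<open>observation_gap\<close>.
\<close>

definition defect :: "real \<Rightarrow> real \<Rightarrow> real ^ 3 \<Rightarrow> real" where
  "defect b c q = (b + c) * (b * q $ 2 + c * q $ 3) - b * c * q $ 1"

lemma defect_scaleR: "defect b c (s *\<^sub>R q) = s * defect b c q"
  by (simp add: defect_def algebra_simps)

text \<open>
  Eliminating \<open>s 1 = - s 2 - s 3\<close> leaves the perfect square \<open>(b * s 2 - c * s 3)\<^sup>2\<close>; the terms
  in \<open>r\<close> collect to \<open>(b + c)\<^sup>2 - b * c\<close>.
\<close>

lemma defect_eq:
  assumes "(\<Sum>e\<in>UNIV. s e) = 0" "\<And>e. q $ e = r\<^sup>2 + (s e)\<^sup>2"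
  shows "defect b c q = r\<^sup>2 * (b\<^sup>2 + b * c + c\<^sup>2) + (b * s 2 - c * s 3)\<^sup>2"
proof -
  have s1: "s 1 = - s 2 - s 3" using assms(1) unfolding sum_3 by simp
  show ?thesis
    unfolding defect_def assms(2) s1 by (simp add: power2_eq_square algebra_simps)
qed

text \<open>
  The equality case has to be read off from a limit of intensities, where \<open>r\<close> and \<open>s\<close> need not
  converge. The second bound is therefore phrased in terms of \<open>q\<close> alone: it is a closed
  condition, and for vanishing defect it forces the ratio of \<open>q $ 2\<close> and \<open>q $ 3\<close>. It comes from
  \<open>b\<^sup>2 * (s 2)\<^sup>2 - c\<^sup>2 * (s 3)\<^sup>2 = (b * s 2 - c * s 3) * (b * s 2 + c * s 3)\<close>, whose first factor is at most
  the square root of the defect.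
\<close>

lemma defect_controls_ratio:
  assumes "b > 0" "c > 0" and rs: "(\<Sum>e\<in>UNIV. s e) = 0" "\<And>e. q $ e = r\<^sup>2 + (s e)\<^sup>2"
  shows "defect b c q \<ge> 0"
    and "\<bar>b\<^sup>2 * q $ 2 - c\<^sup>2 * q $ 3\<bar> \<le>
      defect b c q + sqrt (defect b c q * (2 * (b\<^sup>2 * q $ 2 + c\<^sup>2 * q $ 3)))"
proof -
  let ?d = "defect b c q"
  have bc: "b\<^sup>2 + b * c + c\<^sup>2 \<ge> 0" using assms by simp
  have d: "?d = r\<^sup>2 * (b\<^sup>2 + b * c + c\<^sup>2) + (b * s 2 - c * s 3)\<^sup>2"
    by (rule defect_eq[OF rs])
  then show "?d \<ge> 0" using bc by simp
  have "\<bar>r\<^sup>2 * (b\<^sup>2 - c\<^sup>2)\<bar> \<le> r\<^sup>2 * (b\<^sup>2 + b * c + c\<^sup>2)"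
    unfolding abs_mult using assms(1,2) by (intro mult_mono) (auto simp: abs_le_iff)
  also have "\<dots> \<le> ?d" unfolding d by simp
  finally have 1: "\<bar>r\<^sup>2 * (b\<^sup>2 - c\<^sup>2)\<bar> \<le> ?d" .
  have "(b * s 2 + c * s 3)\<^sup>2 \<le> (b * s 2 + c * s 3)\<^sup>2 + (b * s 2 - c * s 3)\<^sup>2" by simp
  also have "\<dots> = 2 * (b\<^sup>2 * (s 2)\<^sup>2 + c\<^sup>2 * (s 3)\<^sup>2)"
    by (simp add: power2_eq_square algebra_simps)
  also have "\<dots> \<le> 2 * (b\<^sup>2 * q $ 2 + c\<^sup>2 * q $ 3)"
    unfolding rs(2) by (intro mult_left_mono add_mono) auto
  finally have "(b * s 2 - c * s 3)\<^sup>2 * (b * s 2 + c * s 3)\<^sup>2 \<le> ?d * (2 * (b\<^sup>2 * q $ 2 + c\<^sup>2 * q $ 3))"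
    using bc by (intro mult_mono) (auto simp: d)
  then have "sqrt (((b * s 2 - c * s 3) * (b * s 2 + c * s 3))\<^sup>2) \<le>
      sqrt (?d * (2 * (b\<^sup>2 * q $ 2 + c\<^sup>2 * q $ 3)))"
    unfolding power_mult_distrib by (rule real_sqrt_le_mono)
  then have 2: "\<bar>(b * s 2 - c * s 3) * (b * s 2 + c * s 3)\<bar> \<le> sqrt (?d * (2 * (b\<^sup>2 * q $ 2 + c\<^sup>2 * q $ 3)))"
    by simp
  have "b\<^sup>2 * q $ 2 - c\<^sup>2 * q $ 3 = r\<^sup>2 * (b\<^sup>2 - c\<^sup>2) + (b * s 2 - c * s 3) * (b * s 2 + c * s 3)"
    unfolding rs(2) by (simp add: power2_eq_square algebra_simps)
  with 1 2 show "\<bar>b\<^sup>2 * q $ 2 - c\<^sup>2 * q $ 3\<bar> \<le>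
      ?d + sqrt (?d * (2 * (b\<^sup>2 * q $ 2 + c\<^sup>2 * q $ 3)))"
    by linarith
qed

lemma observation_gap:
  assumes "a > 0" "b > 0" "c > 0"
  shows "vector [0, b, c] \<bullet> q - b * c / (a * b + a * c + b * c) * (vector [a, b, c] \<bullet> q) =
    a / (a * b + a * c + b * c) * defect b c q"
proof -
  have "a * b + a * c + b * c > 0" using assms by (simp add: add_pos_pos)
  then show ?thesis
    unfolding inner_vec_def sum_3 defect_def by (simp add: field_simps)
qed

section \<open>Limit intensities\<close>

lemma limit_intensity_approximation:
  fixes l :: "real ^ 'e::finite"
  assumes pos: "\<And>e. l $ e > 0" and q: "q \<in> limit_intensities G l"
  shows "l \<bullet> q = 1"
    and "\<lbrakk>measurable_subset l \<omega>; \<And>e. edge_measures \<omega> $ e = 0 \<or> edge_measures \<omega> $ e = l $ e\<rbrakk> \<Longrightarrow>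
      \<exists>u k. (\<forall>n::nat. k n > 0 \<and> laplace_eigen G l ((k n)\<^sup>2) (u n) \<and> L2_normalized l (u n)) \<and>
        filterlim k at_top sequentially \<and> (\<lambda>n. observed_mass \<omega> (u n)) \<longlonglongrightarrow> edge_measures \<omega> \<bullet> q"
proof -
  obtain D where "D \<ge> 0" and mass:
    "\<And>k u q \<omega>. \<lbrakk>k > 0; has_intensity l k u q; measurable_subset l \<omega>;
       \<And>e. edge_measures \<omega> $ e = 0 \<or> edge_measures \<omega> $ e = l $ e\<rbrakk> \<Longrightarrow>
       \<bar>observed_mass \<omega> u - edge_measures \<omega> \<bullet> q\<bar> \<le> D / k * (edge_measures \<omega> \<bullet> q)"
    and norm:
    "\<And>k u q. \<lbrakk>k > 0; has_intensity l k u q; L2_normalized l u\<rbrakk> \<Longrightarrow> \<bar>1 - l \<bullet> q\<bar> \<le> D / k * (l \<bullet> q)"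
    using observed_mass_approx_intensity[OF pos] by metis
  obtain u k p where kup: "\<And>n. k n > 0" "\<And>n. laplace_eigen G l ((k n)\<^sup>2) (u n)"
    "\<And>n. L2_normalized l (u n)" "\<And>n. has_intensity l (k n) (u n) (p n)"
    and k: "filterlim k at_top sequentially" and p: "p \<longlonglongrightarrow> q"
    using q unfolding limit_intensities_def by blast
  have Dk: "(\<lambda>n. D / k n) \<longlonglongrightarrow> 0"
    using k by (rule real_tendsto_divide_at_top[OF tendsto_const])
  have "(\<lambda>n. D / k n * (l \<bullet> p n)) \<longlonglongrightarrow> 0 * (l \<bullet> q)"
    by (intro tendsto_intros Dk p)
  then have "(\<lambda>n. D / k n * (l \<bullet> p n)) \<longlonglongrightarrow> 0" by simp
  then have "(\<lambda>n. 1 - l \<bullet> p n) \<longlonglongrightarrow> 0"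
    by (rule Lim_null_comparison[OF always_eventually[OF allI], rotated])
      (simp only: real_norm_def norm[OF kup(1,4,3)])
  moreover have "(\<lambda>n. 1 - l \<bullet> p n) \<longlonglongrightarrow> 1 - l \<bullet> q"
    by (intro tendsto_intros p)
  ultimately show "l \<bullet> q = 1"
    using LIMSEQ_unique by fastforce
  show "\<exists>u k. (\<forall>n::nat. k n > 0 \<and> laplace_eigen G l ((k n)\<^sup>2) (u n) \<and> L2_normalized l (u n)) \<and>
        filterlim k at_top sequentially \<and> (\<lambda>n. observed_mass \<omega> (u n)) \<longlonglongrightarrow> edge_measures \<omega> \<bullet> q"
    if \<omega>: "measurable_subset l \<omega>" "\<And>e. edge_measures \<omega> $ e = 0 \<or> edge_measures \<omega> $ e = l $ e"
  proof -
    have "(\<lambda>n. D / k n * (edge_measures \<omega> \<bullet> p n)) \<longlonglongrightarrow> 0 * (edge_measures \<omega> \<bullet> q)"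
      by (intro tendsto_intros Dk p)
    then have "(\<lambda>n. D / k n * (edge_measures \<omega> \<bullet> p n)) \<longlonglongrightarrow> 0" by simp
    then have "(\<lambda>n. observed_mass \<omega> (u n) - edge_measures \<omega> \<bullet> p n) \<longlonglongrightarrow> 0"
      by (rule Lim_null_comparison[OF always_eventually[OF allI], rotated])
        (simp only: real_norm_def mass[OF kup(1,4) \<omega>])
    then have "(\<lambda>n. (observed_mass \<omega> (u n) - edge_measures \<omega> \<bullet> p n) + edge_measures \<omega> \<bullet> p n)
        \<longlonglongrightarrow> 0 + edge_measures \<omega> \<bullet> q"
      by (intro tendsto_add tendsto_intros p)
    then show ?thesis using kup k by (intro exI[of _ u] exI[of _ k]) simp
  qed
qed

lemma Theta3_limit_intensity_defect:
  fixes l :: "real ^ 3"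
  assumes pos: "\<And>e. l $ e > 0" and indep: "rationally_independent l" and "b > 0" "c > 0"
    and q: "q \<in> limit_intensities Theta3 l"
  shows "defect b c q \<ge> 0" and "defect b c q = 0 \<Longrightarrow> b\<^sup>2 * q $ 2 = c\<^sup>2 * q $ 3"
proof -
  obtain u k p where kup: "\<And>n. k n > 0" "\<And>n. laplace_eigen Theta3 l ((k n)\<^sup>2) (u n)"
    "\<And>n. has_intensity l (k n) (u n) (p n)" and p: "p \<longlonglongrightarrow> q"
    using q unfolding limit_intensities_def by blast
  have *: "defect b c (p n) \<ge> 0"
    "\<bar>b\<^sup>2 * p n $ 2 - c\<^sup>2 * p n $ 3\<bar> \<le>
      defect b c (p n) + sqrt (defect b c (p n) * (2 * (b\<^sup>2 * p n $ 2 + c\<^sup>2 * p n $ 3)))" for n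
  proof -
    obtain r s where rs: "(\<Sum>e\<in>UNIV. s e) = (0::real)" "\<And>e. p n $ e = r\<^sup>2 + (s e)\<^sup>2"
      using Theta3_eigenfunction_intensity[OF pos indep kup] by blast
    show "defect b c (p n) \<ge> 0"
      "\<bar>b\<^sup>2 * p n $ 2 - c\<^sup>2 * p n $ 3\<bar> \<le>
        defect b c (p n) + sqrt (defect b c (p n) * (2 * (b\<^sup>2 * p n $ 2 + c\<^sup>2 * p n $ 3)))"
      using defect_controls_ratio[OF \<open>b > 0\<close> \<open>c > 0\<close> rs] by blast+
  qed
  have d: "(\<lambda>n. defect b c (p n)) \<longlonglongrightarrow> defect b c q"
    unfolding defect_def by (intro tendsto_intros p)
  then show "defect b c q \<ge> 0" using *(1) by (intro LIMSEQ_le_const) auto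
  have "(\<lambda>n. \<bar>b\<^sup>2 * p n $ 2 - c\<^sup>2 * p n $ 3\<bar>) \<longlonglongrightarrow> \<bar>b\<^sup>2 * q $ 2 - c\<^sup>2 * q $ 3\<bar>"
    by (intro tendsto_intros p)
  moreover have "(\<lambda>n. defect b c (p n) + sqrt (defect b c (p n) * (2 * (b\<^sup>2 * p n $ 2 + c\<^sup>2 * p n $ 3))))
     \<longlonglongrightarrow> defect b c q + sqrt (defect b c q * (2 * (b\<^sup>2 * q $ 2 + c\<^sup>2 * q $ 3)))"
    by (intro tendsto_intros p d)
  ultimately have "\<bar>b\<^sup>2 * q $ 2 - c\<^sup>2 * q $ 3\<bar> \<le>
      defect b c q + sqrt (defect b c q * (2 * (b\<^sup>2 * q $ 2 + c\<^sup>2 * q $ 3)))"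
    by (rule LIMSEQ_le) (use *(2) in blast)
  then show "b\<^sup>2 * q $ 2 = c\<^sup>2 * q $ 3" if "defect b c q = 0" using that by simp
qed

lemma L2_normalize:
  fixes l :: "real ^ 'e::finite" and v :: "'e \<Rightarrow> real \<Rightarrow> complex"
  assumes "observed_mass (\<lambda>e. {0..l $ e}) v > 0"
  obtains r where "r > 0" "L2_normalized l (\<lambda>e x. of_real r * v e x)"
proof -
  define M where "M = observed_mass (\<lambda>e. {0..l $ e}) v"
  define r where "r = 1 / sqrt M"
  have "M > 0" using assms by (simp add: M_def)
  have "observed_mass (\<lambda>e. {0..l $ e}) (\<lambda>e x. of_real r * v e x) = r\<^sup>2 * M"
    unfolding observed_mass_def M_def sum_distrib_left
    by (simp add: norm_mult power_mult_distrib set_integral_mult_right)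
  also have "\<dots> = 1" using \<open>M > 0\<close> by (simp add: r_def power_divide)
  finally have "L2_normalized l (\<lambda>e x. of_real r * v e x)" by (simp add: L2_normalized_def)
  moreover have "r > 0" using \<open>M > 0\<close> by (simp add: r_def)
  ultimately show thesis using that by blast
qed

text \<open>
  Take even waves with tangents within distance 1 of \<open>(n + 1) * t e\<close>. Their intensities are
  proportional to \<open>1 + (T n e)\<^sup>2\<close>, and after division by \<open>(n + 1)\<^sup>2\<close> only \<open>(t e)\<^sup>2\<close> survives in the limit.
  The scalar factor is pinned down by \<open>l \<bullet> p n\<close>, which tends to 1 by normalization.
\<close>

lemma squares_in_limit_intensities:
  fixes l :: "real ^ 3" and t :: "3 \<Rightarrow> real"
  assumes pos: "\<And>e. l $ e > 0" and indep: "rationally_independent l"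
    and t: "(\<Sum>e\<in>UNIV. t e) = 0" and t1: "t 1 \<noteq> 0"
  defines "v \<equiv> \<chi> e. (t e)\<^sup>2"
  shows "(1 / (l \<bullet> v)) *\<^sub>R v \<in> limit_intensities Theta3 l"
proof -
  obtain D where "D \<ge> 0" and mass:
    "\<And>k u q \<omega>. \<lbrakk>k > 0; has_intensity l k u q; measurable_subset l \<omega>;
       \<And>e. edge_measures \<omega> $ e = 0 \<or> edge_measures \<omega> $ e = l $ e\<rbrakk> \<Longrightarrow>
       \<bar>observed_mass \<omega> u - edge_measures \<omega> \<bullet> q\<bar> \<le> D / k * (edge_measures \<omega> \<bullet> q)"
    and norm:
    "\<And>k u q. \<lbrakk>k > 0; has_intensity l k u q; L2_normalized l u\<rbrakk> \<Longrightarrow> \<bar>1 - l \<bullet> q\<bar> \<le> D / k * (l \<bullet> q)"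
    using observed_mass_approx_intensity[OF pos] by metis
  have inner_pos: "l \<bullet> w > 0" if "\<And>e. w $ e \<ge> 0" "w $ 1 > 0" for w
    unfolding inner_vec_def sum_3 using pos that
    by (intro add_pos_nonneg) (auto simp: less_imp_le)
  \<comment> \<open>The lower bound exceeds \<open>D\<close> so that the relative error \<open>D / k\<close> stays below 1, which makes the
    mass of the wave positive and its normalization possible.\<close>
  have "\<exists>k. k > D + real n \<and> (\<forall>e. cos (k * l $ e / 2) \<noteq> 0) \<and> (\<Sum>e\<in>UNIV. tan (k * l $ e / 2)) = 0 \<and>
      (\<forall>e. \<bar>tan (k * l $ e / 2) - real (Suc n) * t e\<bar> < 1)" for n
  proof -
    have "(\<Sum>e\<in>UNIV. real (Suc n) * t e) = 0"
      using t by (simp add: sum_distrib_left[symmetric] del: of_nat_Suc)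
    then obtain k where "k > D + real n" "\<And>e. cos (k * l $ e / 2) \<noteq> 0"
      "(\<Sum>e\<in>UNIV. tan (k * l $ e / 2)) = 0" "\<And>e. \<bar>tan (k * l $ e / 2) - real (Suc n) * t e\<bar> < 1"
      using tan_sum_zero_near[OF indep pos _ zero_less_one, of "\<lambda>e. real (Suc n) * t e"] by metis
    then show ?thesis by blast
  qed
  then have "\<exists>k. \<forall>n. k n > D + real n \<and> (\<forall>e. cos (k n * l $ e / 2) \<noteq> 0) \<and>
      (\<Sum>e\<in>UNIV. tan (k n * l $ e / 2)) = 0 \<and>
      (\<forall>e. \<bar>tan (k n * l $ e / 2) - real (Suc n) * t e\<bar> < 1)"
    by (intro choice allI)
  then obtain k where k: "\<And>n. k n > D + real n" "\<And>n e. cos (k n * l $ e / 2) \<noteq> 0"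
      "\<And>n. (\<Sum>e\<in>UNIV. tan (k n * l $ e / 2)) = 0"
      "\<And>n e. \<bar>tan (k n * l $ e / 2) - real (Suc n) * t e\<bar> < 1"
    by blast
  have k0: "k n > 0" and kD: "k n > D" for n using k(1)[of n] \<open>D \<ge> 0\<close> by simp_all
  define T where "T n e = tan (k n * l $ e / 2)" for n e
  define C :: "real \<Rightarrow> nat \<Rightarrow> complex ^ (3 + 3)" where "C r n = (\<chi> i. complex_of_real (case i of Inl e \<Rightarrow> r | Inr e \<Rightarrow> r * T n e))" for r n
  have C: "C r n \<in> phase_kernel Theta3 (k n *\<^sub>R l)" for r n
    unfolding C_def T_def
    by (rule even_wave_in_Theta3_kernel[of "k n *\<^sub>R l" r, unfolded vector_scaleR_component real_scaleR_def, OF k(2,3)])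
  have int: "intensity (C r n) $ e = r\<^sup>2 * (1 + (T n e)\<^sup>2) / 2" for r n e
    by (simp add: intensity_def C_def norm_mult power_mult_distrib algebra_simps)
  have wC: "wave (k n) (C r n) e x = of_real r * wave (k n) (C 1 n) e x" for r n e x
    by (simp add: wave_def C_def algebra_simps)
  have hasint: "has_intensity l (k n) (wave (k n) (C r n)) (intensity (C r n))" for r n
    unfolding has_intensity_iff by blast
  have "\<exists>r>0. L2_normalized l (wave (k n) (C r n))" for n
  proof -
    have em: "edge_measures (\<lambda>e. {0..l $ e}) = l"
      using pos by (simp add: edge_measures_def vec_eq_iff less_imp_le)
    have "\<bar>observed_mass (\<lambda>e. {0..l $ e}) (wave (k n) (C 1 n)) - l \<bullet> intensity (C 1 n)\<bar>
        \<le> D / k n * (l \<bullet> intensity (C 1 n))"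
      using mass[OF k0 hasint, of "\<lambda>e. {0..l $ e}"] unfolding em by (simp add: measurable_subset_def)
    moreover have "D / k n * (l \<bullet> intensity (C 1 n)) < 1 * (l \<bullet> intensity (C 1 n))"
      using kD[of n] k0[of n]
      by (intro mult_strict_right_mono inner_pos) (auto simp: int add_pos_nonneg)
    ultimately have "observed_mass (\<lambda>e. {0..l $ e}) (wave (k n) (C 1 n)) > 0" by linarith
    then obtain r where r: "r > 0" "L2_normalized l (\<lambda>e x. of_real r * wave (k n) (C 1 n) e x)"
      by (rule L2_normalize)
    have "wave (k n) (C r n) = (\<lambda>e x. of_real r * wave (k n) (C 1 n) e x)"
      by (intro ext) (rule wC)
    with r show ?thesis by metis
  qed
  then obtain r where r: "\<And>n. r n > 0" and normal: "\<And>n. L2_normalized l (wave (k n) (C (r n) n))"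
    by metis
  define p where "p n = intensity (C (r n) n)" for n
  define w where "w n = (\<chi> e. (1 / real (Suc n))\<^sup>2 + (T n e / real (Suc n))\<^sup>2)" for n
  have lw: "l \<bullet> w n > 0" for n
    by (rule inner_pos) (auto simp: w_def add_pos_nonneg)
  have p_w: "p n = ((r n * real (Suc n))\<^sup>2 / 2) *\<^sub>R w n" for n
    unfolding vec_eq_iff p_def int vector_scaleR_component w_def vec_lambda_beta
    by (simp add: field_simps del: of_nat_Suc)
  have p_eq: "p n = ((l \<bullet> p n) / (l \<bullet> w n)) *\<^sub>R w n" for n
    using lw[of n] unfolding p_w by simp
  have k_lim: "filterlim k at_top sequentially"
  proof (rule filterlim_at_top_mono[OF filterlim_real_sequentially], intro always_eventually allI)
    show "real n \<le> k n" for n using k(1)[of n] \<open>D \<ge> 0\<close> by simp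
  qed
  have Dk: "(\<lambda>n. D / k n) \<longlonglongrightarrow> 0"
    using k_lim by (rule real_tendsto_divide_at_top[OF tendsto_const])
  have lp: "(\<lambda>n. l \<bullet> p n) \<longlonglongrightarrow> 1"
  proof (rule tendsto_sandwich)
    have "\<bar>1 - l \<bullet> p n\<bar> \<le> D / k n * (l \<bullet> p n)" for n
      unfolding p_def by (rule norm[OF k0 hasint normal])
    then have b: "1 \<le> (1 + D / k n) * (l \<bullet> p n)" "(1 - D / k n) * (l \<bullet> p n) \<le> 1" for n
      by (simp_all add: abs_le_iff algebra_simps)
    have D1: "1 + D / k n > 0" "1 - D / k n > 0" for n
      using kD[of n] k0[of n] \<open>D \<ge> 0\<close> by (simp_all add: add_pos_nonneg)
    show "\<forall>\<^sub>F n in sequentially. 1 / (1 + D / k n) \<le> l \<bullet> p n"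
      using b(1) D1(1) by (intro always_eventually allI) (simp add: pos_divide_le_eq mult.commute)
    show "\<forall>\<^sub>F n in sequentially. l \<bullet> p n \<le> 1 / (1 - D / k n)"
      using b(2) D1(2) by (intro always_eventually allI) (simp add: pos_le_divide_eq mult.commute)
    show "(\<lambda>n. 1 / (1 + D / k n)) \<longlonglongrightarrow> 1"
      using tendsto_divide[OF tendsto_const[of 1] tendsto_add[OF tendsto_const[of 1] Dk]] by simp
    show "(\<lambda>n. 1 / (1 - D / k n)) \<longlonglongrightarrow> 1"
      using tendsto_divide[OF tendsto_const[of 1] tendsto_diff[OF tendsto_const[of 1] Dk]] by simp
  qed
  have inv: "(\<lambda>n. 1 / real (Suc n)) \<longlonglongrightarrow> 0"
    by (rule LIMSEQ_Suc[OF lim_1_over_n])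
  have w: "w \<longlonglongrightarrow> v"
  proof (rule vec_tendstoI)
    fix e
    have "(\<lambda>n. T n e / real (Suc n) - t e) \<longlonglongrightarrow> 0"
    proof (rule Lim_null_comparison[OF always_eventually inv], rule allI)
      fix n
      have "T n e / real (Suc n) - t e = (T n e - real (Suc n) * t e) / real (Suc n)"
        by (simp add: field_simps del: of_nat_Suc)
      then show "norm (T n e / real (Suc n) - t e) \<le> 1 / real (Suc n)"
        using k(4)[of n e] by (simp add: T_def divide_right_mono)
    qed
    then have "(\<lambda>n. T n e / real (Suc n)) \<longlonglongrightarrow> t e"
      by (rule LIM_zero_cancel)
    from tendsto_add[OF tendsto_power[OF inv, of 2] tendsto_power[OF this, of 2]]
    show "(\<lambda>n. w n $ e) \<longlonglongrightarrow> v $ e"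
      by (simp add: w_def v_def)
  qed
  have lv: "l \<bullet> v > 0"
    by (rule inner_pos) (use t1 in \<open>auto simp: v_def\<close>)
  have "(\<lambda>n. ((l \<bullet> p n) / (l \<bullet> w n)) *\<^sub>R w n) \<longlonglongrightarrow> (1 / (l \<bullet> v)) *\<^sub>R v"
    using lv by (intro tendsto_intros lp w) auto
  then have "p \<longlonglongrightarrow> (1 / (l \<bullet> v)) *\<^sub>R v"
    unfolding p_eq[symmetric] .
  moreover have "laplace_eigen Theta3 l ((k n)\<^sup>2) (wave (k n) (C (r n) n))" for n
    using laplace_eigen_iff_wave[OF k0 pos] C by blast
  ultimately show ?thesis
    unfolding limit_intensities_def using k0 normal k_lim hasint[folded p_def]
    by (intro CollectI exI[of _ "\<lambda>n. wave (k n) (C (r n) n)"] exI[of _ k] exI[of _ p])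
      (auto simp: p_def hasint)
qed

section \<open>The observation constant\<close>

text \<open>
  For normalized eigenfunctions above a large spectral level \<open>L\<close>, the infimum is squeezed between
  \<open>(1 - 2 * D / sqrt L) * C\<close> and \<open>C\<close>: the lower bound on intensities survives the passage to masses up to
  the relative error, and a sequence realizing \<open>q\<close> has members above every level \<open>L\<close>.
\<close>

lemma C_infty_eqI:
  fixes l \<alpha> :: "real ^ 'e::finite"
  assumes pos: "\<And>e. l $ e > 0" and \<omega>: "measurable_subset l \<omega>" "edge_measures \<omega> = \<alpha>"
    and \<alpha>: "\<And>e. \<alpha> $ e = 0 \<or> \<alpha> $ e = l $ e" and "C \<ge> 0"
    and lower: "\<And>k u q. \<lbrakk>k > 0; laplace_eigen G l (k\<^sup>2) u; has_intensity l k u q\<rbrakk> \<Longrightarrow> C * (l \<bullet> q) \<le> \<alpha> \<bullet> q"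
    and attained: "q \<in> limit_intensities G l" "\<alpha> \<bullet> q = C"
  shows "C_infty G l \<omega> = ereal C"
proof -
  define F where "F L = Inf {ereal (observed_mass \<omega> u) | u lam.
      laplace_eigen G l lam u \<and> lam \<ge> L \<and> L2_normalized l u}" for L
  obtain D where "D \<ge> 0" and mass:
    "\<And>k u q \<omega>. \<lbrakk>k > 0; has_intensity l k u q; measurable_subset l \<omega>;
       \<And>e. edge_measures \<omega> $ e = 0 \<or> edge_measures \<omega> $ e = l $ e\<rbrakk> \<Longrightarrow>
       \<bar>observed_mass \<omega> u - edge_measures \<omega> \<bullet> q\<bar> \<le> D / k * (edge_measures \<omega> \<bullet> q)"
    and norm:
    "\<And>k u q. \<lbrakk>k > 0; has_intensity l k u q; L2_normalized l u\<rbrakk> \<Longrightarrow> \<bar>1 - l \<bullet> q\<bar> \<le> D / k * (l \<bullet> q)"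
    using observed_mass_approx_intensity[OF pos] by metis
  have fn: "\<And>e. edge_measures \<omega> $ e = 0 \<or> edge_measures \<omega> $ e = l $ e"
    using \<alpha> \<omega>(2) by simp
  have upper: "F L \<le> ereal C" for L
  proof -
    obtain u k where uk: "\<And>n::nat. k n > 0" "\<And>n. laplace_eigen G l ((k n)\<^sup>2) (u n)"
      "\<And>n. L2_normalized l (u n)" and k: "filterlim k at_top sequentially"
      and obs: "(\<lambda>n. observed_mass \<omega> (u n)) \<longlonglongrightarrow> C"
      using limit_intensity_approximation(2)[OF pos attained(1) \<omega>(1) fn] attained(2) \<omega>(2) by auto
    have "\<forall>\<^sub>F n in sequentially. k n \<ge> max 1 L"
      using k unfolding filterlim_at_top by blast
    then have "\<forall>\<^sub>F n in sequentially. F L \<le> ereal (observed_mass \<omega> (u n))"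
    proof eventually_elim
      case (elim n)
      then have "1 * k n \<le> k n * k n" by (intro mult_right_mono) auto
      with elim have "(k n)\<^sup>2 \<ge> L" unfolding power2_eq_square by linarith
      then show ?case
        unfolding F_def using uk by (intro Inf_lower) blast
    qed
    moreover have "(\<lambda>n. ereal (observed_mass \<omega> (u n))) \<longlonglongrightarrow> ereal C"
      using obs by simp
    ultimately show ?thesis
      by (intro tendsto_lowerbound[OF _ _ sequentially_bot])
  qed
  \<comment> \<open>For these \<open>L\<close> the relative error is at most 1/2, so that \<open>1 - 2 * \<delta>\<close> is nonnegative below.\<close>
  have below: "ereal ((1 - 2 * (D / sqrt L)) * C) \<le> F L" if L: "sqrt L \<ge> 2 * D + 1" for L
    unfolding F_def
  proof (rule Inf_greatest)
    fix x assume "x \<in> {ereal (observed_mass \<omega> u) | u lam.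
      laplace_eigen G l lam u \<and> lam \<ge> L \<and> L2_normalized l u}"
    then obtain u lam where x: "x = ereal (observed_mass \<omega> u)"
      and u: "laplace_eigen G l lam u" "lam \<ge> L" "L2_normalized l u" by blast
    define k where "k = sqrt lam"
    have "sqrt L > 0" using L \<open>D \<ge> 0\<close> by linarith
    moreover have "k \<ge> sqrt L" unfolding k_def using u(2) by (rule real_sqrt_le_mono)
    ultimately have k: "k \<ge> sqrt L" "k > 0" by linarith+
    then have "lam > 0" by (simp add: k_def)
    then have lam: "lam = k\<^sup>2" by (simp add: k_def)
    obtain q where q: "has_intensity l k u q"
      using u(1) laplace_eigen_iff_wave[OF k(2) pos] unfolding lam has_intensity_iff by blast
    define \<delta> where "\<delta> = D / k"
    have "D / sqrt L \<le> 1 / 2"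
      using L \<open>sqrt L > 0\<close> by (simp add: pos_divide_le_eq)
    moreover have "\<delta> \<le> D / sqrt L"
      unfolding \<delta>_def using k \<open>sqrt L > 0\<close> \<open>D \<ge> 0\<close> by (intro divide_left_mono mult_pos_pos)
    moreover have "0 \<le> \<delta>" using k \<open>D \<ge> 0\<close> by (simp add: \<delta>_def)
    ultimately have \<delta>: "0 \<le> \<delta>" "\<delta> \<le> D / sqrt L" "\<delta> \<le> 1 / 2" by linarith+
    have lq: "1 \<le> (1 + \<delta>) * (l \<bullet> q)"
      using norm[OF k(2) q u(3)] by (simp add: \<delta>_def abs_le_iff algebra_simps)
    have obs: "(1 - \<delta>) * (\<alpha> \<bullet> q) \<le> observed_mass \<omega> u"
      using mass[OF k(2) q \<omega>(1) fn] unfolding \<omega>(2) by (simp add: \<delta>_def abs_le_iff algebra_simps)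
    have "0 \<le> l \<bullet> q"
      using lq \<delta>(1) by (smt (verit) mult_nonneg_nonpos)
    have "1 - 2 * (D / sqrt L) \<le> (1 - 2 * \<delta>) * 1" using \<delta>(2) by simp
    also have "\<dots> \<le> (1 - 2 * \<delta>) * ((1 + \<delta>) * (l \<bullet> q))"
      using lq \<delta>(3) by (intro mult_left_mono) auto
    also have "\<dots> = (1 - \<delta>) * (l \<bullet> q) - 2 * \<delta>\<^sup>2 * (l \<bullet> q)"
      by (simp add: power2_eq_square algebra_simps)
    also have "\<dots> \<le> (1 - \<delta>) * (l \<bullet> q)" using \<open>0 \<le> l \<bullet> q\<close> by simp
    finally have "(1 - 2 * (D / sqrt L)) * C \<le> (1 - \<delta>) * (l \<bullet> q) * C"
      using \<open>C \<ge> 0\<close> by (rule mult_right_mono)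
    also have "\<dots> = (1 - \<delta>) * (C * (l \<bullet> q))" by simp
    also have "\<dots> \<le> (1 - \<delta>) * (\<alpha> \<bullet> q)"
      using lower[OF k(2) u(1)[unfolded lam] q] \<delta>(3) by (intro mult_left_mono) auto
    finally show "ereal ((1 - 2 * (D / sqrt L)) * C) \<le> x"
      using obs unfolding x by simp
  qed
  have "((\<lambda>L. (1 - 2 * (D / sqrt L)) * C) \<longlongrightarrow> (1 - 2 * 0) * C) at_top"
    by (intro tendsto_intros real_tendsto_divide_at_top[OF tendsto_const] sqrt_at_top)
  then have "((\<lambda>L. ereal ((1 - 2 * (D / sqrt L)) * C)) \<longlongrightarrow> ereal C) at_top"
    by simp
  moreover have "\<forall>\<^sub>F L in at_top. sqrt L \<ge> 2 * D + 1"
    using sqrt_at_top unfolding filterlim_at_top by blast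
  then have "\<forall>\<^sub>F L in at_top. ereal ((1 - 2 * (D / sqrt L)) * C) \<le> F L"
    by eventually_elim (rule below)
  ultimately have "(F \<longlongrightarrow> ereal C) at_top"
    by (rule tendsto_sandwich[OF _ always_eventually[OF allI[OF upper]] _ tendsto_const, rotated])
  then show ?thesis
    unfolding C_infty_def F_def by (intro tendsto_Lim trivial_limit_at_top_linorder)
qed

lemma two_edge_cycles_Theta3: "two_edge_cycles Theta3 = {{1, 2}, {1, 3}, {2, 3}}"
proof -
  have "two_edge_cycles Theta3 = {{e, f} | e f. e \<noteq> f}"
    by (simp add: two_edge_cycles_def Theta3_def)
  also have "\<dots> = {{1, 2}, {1, 3}, {2, 3}}"
  proof (intro equalityI subsetI)
    fix P :: "3 set" assume "P \<in> {{e, f} | e f. e \<noteq> f}"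
    then obtain e f where "P = {e, f}" "e \<noteq> f" by blast
    then show "P \<in> {{1, 2}, {1, 3}, {2, 3}}"
      using exhaust_3[of e] exhaust_3[of f] by (elim disjE) (simp_all add: doubleton_eq_iff)
  next
    fix P :: "3 set" assume P: "P \<in> {{1, 2}, {1, 3}, {2, 3}}"
    have "(1::3) \<noteq> 2" "(1::3) \<noteq> 3" "(2::3) \<noteq> 3" by simp_all
    with P show "P \<in> {{e, f} | e f. e \<noteq> f}" by blast
  qed
  finally show ?thesis .
qed

theorem proposition3p5:
  fixes a b c :: real and l \<alpha> :: "real ^ 3" and \<omega> :: "3 \<Rightarrow> real set"
  assumes "l = vector [a, b, c]"
    and "l \<in> generic_class Theta3"
    and "\<alpha> = vector [0, b, c]"
    and "measurable_subset l \<omega>"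
    and "edge_measures \<omega> = \<alpha>"
  shows "C_infty Theta3 l \<omega> = ereal (b * c / (a * b + a * c + b * c)) \<and>
    C_prim_Theta3 l \<alpha> = min (b / (a + b)) (c / (a + c)) \<and>
    C_infty Theta3 l \<omega> < ereal (C_prim_Theta3 l \<alpha>) \<and>
    (\<exists>q. minimizing_intensity Theta3 l \<alpha> q) \<and>
    (\<forall>q. minimizing_intensity Theta3 l \<alpha> q \<longrightarrow>
       (\<exists>s>0. q = s *\<^sub>R vector [(b + c)\<^sup>2, c\<^sup>2, b\<^sup>2]) \<and>
       edge_support q = UNIV \<and>
       (\<forall>P\<in>two_edge_cycles Theta3. \<not> edge_support q \<subseteq> P))"
proof -
  define C where "C = b * c / (a * b + a * c + b * c)"
  define v :: "real ^ 3" where "v = vector [(b + c)\<^sup>2, c\<^sup>2, b\<^sup>2]"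
  have pos: "\<And>e. l $ e > 0" and indep: "rationally_independent l"
    using assms(2) by (auto simp: generic_class_def)
  have abc: "a > 0" "b > 0" "c > 0"
    using pos[of 1] pos[of 2] pos[of 3] by (simp_all add: assms(1))
  have S: "a * b + a * c + b * c > 0" using abc by (simp add: add_pos_pos)
  define \<kappa> where "\<kappa> = a / (a * b + a * c + b * c)"
  have gap: "\<alpha> \<bullet> q = C * (l \<bullet> q) + \<kappa> * defect b c q" for q
    using observation_gap[OF abc, of q] unfolding C_def \<kappa>_def assms(1,3) by linarith
  have aS: "\<kappa> > 0" using abc S by (simp add: \<kappa>_def)
  define q0 where "q0 = (1 / (l \<bullet> v)) *\<^sub>R v"
  have q0: "q0 \<in> limit_intensities Theta3 l"
  proof -
    \<comment> \<open>The direction of sum zero with \<open>b * t 2 = c * t 3\<close>, on which the perfect square in the defect vanishes.\<close>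
    define t where "t e = (vector [- (b + c), c, b] :: real ^ 3) $ e" for e
    have "(\<chi> e. (t e)\<^sup>2) = v"
      by (simp add: vec_eq_iff forall_3 t_def v_def power2_eq_square algebra_simps)
    moreover have "(\<Sum>e\<in>UNIV. t e) = 0" "t 1 \<noteq> 0"
      using abc by (simp_all add: sum_3 t_def)
    ultimately show ?thesis
      using squares_in_limit_intensities[OF pos indep, of t] by (simp add: q0_def)
  qed
  have "defect b c q0 = (1 / (l \<bullet> v)) * defect b c v"
    unfolding q0_def by (rule defect_scaleR)
  also have "defect b c v = 0"
    by (simp add: defect_def v_def power2_eq_square algebra_simps)
  finally have "\<alpha> \<bullet> q0 = C"
    using limit_intensity_approximation(1)[OF pos q0] unfolding gap by simp
  have lim: "l \<bullet> q = 1" "defect b c q \<ge> 0" "defect b c q = 0 \<Longrightarrow> b\<^sup>2 * q $ 2 = c\<^sup>2 * q $ 3"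
    if "q \<in> limit_intensities Theta3 l" for q
    using limit_intensity_approximation(1)[OF pos that]
      Theta3_limit_intensity_defect[OF pos indep abc(2,3) that] by auto
  have C_infty: "C_infty Theta3 l \<omega> = ereal C"
  proof (rule C_infty_eqI[OF pos assms(4,5) _ _ _ q0 \<open>\<alpha> \<bullet> q0 = C\<close>])
    show "\<alpha> $ e = 0 \<or> \<alpha> $ e = l $ e" for e
      using exhaust_3[of e] by (auto simp: assms(1,3))
    show "C \<ge> 0" using abc S by (simp add: C_def)
    fix k u q assume kuq: "k > 0" "laplace_eigen Theta3 l (k\<^sup>2) u" "has_intensity l k u q"
    obtain r s where rs: "(\<Sum>e\<in>UNIV. s e) = (0::real)" "\<And>e. q $ e = r\<^sup>2 + (s e)\<^sup>2"
      using Theta3_eigenfunction_intensity[OF pos indep kuq] by blast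
    have "defect b c q \<ge> 0" by (rule defect_controls_ratio(1)[OF abc(2,3) rs])
    then show "C * (l \<bullet> q) \<le> \<alpha> \<bullet> q" using aS unfolding gap by simp
  qed
  have C_prim: "C_prim_Theta3 l \<alpha> = min (b / (a + b)) (c / (a + c))"
  proof -
    have "(2::3) \<noteq> 3" "(1::3) \<noteq> 2" "(1::3) \<noteq> 3" by simp_all
    then have "(\<lambda>P. (\<Sum>e\<in>P. \<alpha> $ e) / (\<Sum>e\<in>P. l $ e)) ` two_edge_cycles Theta3 =
        {b / (a + b), c / (a + c), 1}"
      unfolding two_edge_cycles_Theta3 using abc by (simp add: assms(1,3))
    moreover have "c / (a + c) \<le> 1" using abc by simp
    ultimately show ?thesis unfolding C_prim_Theta3_def by simp
  qed
  have less: "C < min (b / (a + b)) (c / (a + c))"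
  proof -
    have "C < b / (a + b)" "C < c / (a + c)"
      unfolding C_def using abc S by (simp_all add: divide_simps algebra_simps add_pos_pos)
    then show ?thesis by simp
  qed
  have min0: "minimizing_intensity Theta3 l \<alpha> q0"
    unfolding minimizing_intensity_def \<open>\<alpha> \<bullet> q0 = C\<close>
    using q0 lim aS by (simp add: gap)
  have "(\<exists>s>0. q = s *\<^sub>R v) \<and> edge_support q = UNIV"
    if q: "minimizing_intensity Theta3 l \<alpha> q" for q
  proof -
    have qI: "q \<in> limit_intensities Theta3 l" and "\<alpha> \<bullet> q \<le> \<alpha> \<bullet> q0"
      using q q0 by (auto simp: minimizing_intensity_def)
    then have "\<kappa> * defect b c q \<le> 0"
      using lim(1)[OF qI] unfolding \<open>\<alpha> \<bullet> q0 = C\<close> gap[of q] by simp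
    then have d: "defect b c q = 0"
      using lim(2)[OF qI] aS by (simp add: mult_le_0_iff)
    define s where "s = q $ 3 / b\<^sup>2"
    have q3: "q $ 3 = s * b\<^sup>2" using abc by (simp add: s_def)
    have "b\<^sup>2 * q $ 2 = b\<^sup>2 * (s * c\<^sup>2)"
      using lim(3)[OF qI d] unfolding q3 by (simp add: algebra_simps)
    then have q2: "q $ 2 = s * c\<^sup>2" using abc by simp
    have "b * c * q $ 1 = b * c * (s * (b + c)\<^sup>2)"
      using d unfolding defect_def q2 q3 by (simp add: power2_eq_square algebra_simps)
    then have q1: "q $ 1 = s * (b + c)\<^sup>2" using abc by simp
    have qv: "q = s *\<^sub>R v"
      by (simp add: vec_eq_iff forall_3 v_def q1 q2 q3)
    have "l \<bullet> v > 0"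
      using abc by (simp add: inner_vec_def sum_3 v_def assms(1) add_pos_pos)
    moreover have "s * (l \<bullet> v) = 1" using lim(1)[OF qI] unfolding qv by simp
    ultimately have "s > 0" by (metis zero_less_mult_pos2 zero_less_one)
    moreover have "edge_support q = UNIV"
    proof -
      have "\<forall>e. q $ e \<noteq> 0"
        unfolding forall_3 q1 q2 q3 using abc \<open>s > 0\<close> by simp
      then show ?thesis by (simp add: edge_support_def)
    qed
    ultimately show ?thesis using qv by blast
  qed
  moreover have "\<not> UNIV \<subseteq> P" if "P \<in> two_edge_cycles Theta3" for P
  proof -
    have "(3::3) \<notin> {1, 2}" "(2::3) \<notin> {1, 3}" "(1::3) \<notin> {2, 3}" by simp_all
    then show ?thesis using that unfolding two_edge_cycles_Theta3 by blast
  qed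
  ultimately show ?thesis
    using C_infty C_prim less min0 unfolding C_def[symmetric] v_def[symmetric] by auto
qed

end
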